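(* For any sequence $\{r_{n,T}\}_{n,T\ge 1}$ increasing to infinity, if $\log(T)=o(n)$, then for all $\epsilon>0$, $$\mathbb{P}_{\theta^*}\left(\sup_{(\Gamma,\pi)\in\Theta}\left|M_{n,T}(\Gamma,\pi)-\mathbb{M}(\pi)\right|>\frac{\epsilon\, r_{n,T}}{\sqrt n}\right)\xrightarrow[n,T\to\infty]{}0 .$$
   Context: Notation: $[M]=\{1,\dots,M\}$. Fix the number of classes $Q\ge 2$ and constants $0<\delta<1/Q$, $0<\zeta<1/2$. Model. There are $n$ nodes observed at times $t=1,\dots,T$. The latent labels $Z_i=(Z_i^1,\dots,Z_i^T)$, $i\in[n]$, are i.i.d. homogeneous stationary Markov chains on $[Q]$ with transition matrix $\Gamma=(\gamma_{ql})_{q,l\in[Q]}$, $\gamma_{ql}=\mathbb{P}(Z_i^{t+1}=l\mid Z_i^t=q)$, started from the stationary distribution $\alpha=(\alpha_q)_{q\in[Q]}$ of $\Gamma$. Write $Z^t=(Z_1^t,\dots,Z_n^t)$, $Z^{1:T}=(Z^1,\dots,Z^T)$. The observations $X^{1:T}=(X^1,\dots,X^T)$ are symmetric binary adjacency matrices $X^t=(X^t_{ij})_{i,j\in[n]}$ with $X^t_{ii}=0$; conditionally on $Z^{1:T}$, the $X^t_{ij}$ ($i<j$, $t\in[T]$) are independent and $X^t_{ij}$ is Bernoulli with parameter $\pi_{Z^t_iZ^t_j}$, where $\pi=(\pi_{ql})$ is a symmetric $Q\times Q$ matrix. The parameter is $\theta=(\Gamma,\pi)$ and $\mathbb{P}_\theta$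 is the law of all variables under $\theta$. $\Theta$ is the set of $\theta=(\Gamma,\pi)$ with $\Gamma$ stochastic and $\pi$ symmetric such that: for all $q\ne q'$ there is $l$ with $\pi_{ql}\neq\pi_{q'l}$; $\gamma_{ql}\in[\delta,1-\delta]$ for all $q,l$; $\pi_{ql}\in[\zeta,1-\zeta]$ for all $q,l$. The true parameter is $\theta^*=(\Gamma^*,\pi^* )\in\Theta$, with stationary distribution $\alpha^*$ of $\Gamma^*$. $M_{n,T}(\Gamma,\pi)=\frac{2}{n(n-1)T}\log\mathbb{P}_\theta(X^{1:T})$ is the normalized log-likelihood. With $\mathcal{A}$ the set of $Q\times Q$ stochastic matrices, for $A=(a_{ql})\in\mathcal{A}$, $$\mathbb{M}(\pi,A)=\sum_{q,l}\alpha^*_q\alpha^*_l\sum_{q',l'}a_{qq'}a_{ll'}\left[\pi^*_{ql}\log\pi_{q'l'}+(1-\pi^*_{ql})\log(1-\pi_{q'l'})\right],\qquad \mathbb{M}(\pi)=\sup_{A\in\mathcal{A}}\mathbb{M}(\pi,A).$$ Asymptotics: limits and $o(\cdot)$ are for $n\to\infty$ and $T\to\infty$ jointly; $\log T=o(n)$ restricts the joint regime. A sequence increasing to infinity is a positive sequence tending to $+\infty$ in this regime. *)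

theory Defs
  imports "HOL-Probability.Probability" "HOL-Library.Landau_Symbols"
begin

text \<open>
  Dynamic stochastic block model. The label set \<open>[Q]\<close> is a finite type \<open>'q\<close>, nodes are
  \<open>1, \<dots>, n\<close> and times are \<open>1, \<dots>, T\<close>.
\<close>

definition stochastic_vector :: "real ^ 'q::finite \<Rightarrow> bool" where
  "stochastic_vector v \<longleftrightarrow> (\<forall>q. 0 \<le> v $ q) \<and> (\<Sum>q\<in>UNIV. v $ q) = 1"

definition stochastic_matrix :: "real ^ 'q ^ 'q::finite \<Rightarrow> bool" where
  "stochastic_matrix A \<longleftrightarrow> (\<forall>q. stochastic_vector (A $ q))"

text \<open>
  The description is unique whenever \<open>\<Gamma>\<close> is stochastic with positive entries, in particular for
  the first component of every element of \<open>param_space\<close> below with \<open>\<delta> > 0\<close>.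
\<close>

definition stationary_distribution :: "real ^ 'q ^ 'q::finite \<Rightarrow> real ^ 'q" where
  "stationary_distribution \<Gamma> = (THE \<alpha>. stochastic_vector \<alpha> \<and> \<alpha> v* \<Gamma> = \<alpha>)"

text \<open>Only meaningful for a \<^const>\<open>stochastic_vector\<close>.\<close>

definition vec_pmf :: "real ^ 'q::finite \<Rightarrow> 'q pmf" where
  "vec_pmf v = embed_pmf (\<lambda>q. v $ q)"

text \<open>The path \<open>(Z\<^sup>1, \<dots>, Z\<^sup>T)\<close> is a function on times, \<open>undefined\<close> outside \<open>{1..T}\<close>.\<close>

primrec markov_chain_pmf ::
  "real ^ 'q \<Rightarrow> real ^ 'q ^ 'q::finite \<Rightarrow> nat \<Rightarrow> (nat \<Rightarrow> 'q) pmf" where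
  "markov_chain_pmf \<alpha> \<Gamma> 0 = return_pmf (\<lambda>_. undefined)"
| "markov_chain_pmf \<alpha> \<Gamma> (Suc T) =
     bind_pmf (markov_chain_pmf \<alpha> \<Gamma> T) (\<lambda>z.
       map_pmf (\<lambda>q. z(Suc T := q)) (vec_pmf (if T = 0 then \<alpha> else \<Gamma> $ z T)))"

text \<open>\<open>Z i t\<close> is the label of node \<open>i\<close> at time \<open>t\<close>.\<close>

definition labels_pmf :: "nat \<Rightarrow> nat \<Rightarrow> real ^ 'q ^ 'q::finite \<Rightarrow> (nat \<Rightarrow> nat \<Rightarrow> 'q) pmf" where
  "labels_pmf n T \<Gamma> =
     Pi_pmf {1..n} (\<lambda>_. undefined) (\<lambda>i. markov_chain_pmf (stationary_distribution \<Gamma>) \<Gamma> T)"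

definition edge_indices :: "nat \<Rightarrow> nat \<Rightarrow> (nat \<times> nat \<times> nat) set" where
  "edge_indices n T = {(t, i, j). t \<in> {1..T} \<and> i \<in> {1..n} \<and> j \<in> {1..n} \<and> i < j}"

text \<open>
  The symmetric binary matrix with zero diagonal determined by its entries above the diagonal.
\<close>

definition adjacency :: "(nat \<times> nat \<times> nat \<Rightarrow> bool) \<Rightarrow> nat \<Rightarrow> nat \<Rightarrow> nat \<Rightarrow> bool" where
  "adjacency e t i j = (if i < j then e (t, i, j) else if j < i then e (t, j, i) else False)"

text \<open>Conditional law of \<open>X\<close> given the labels; \<open>X t i j\<close> states that \<open>X\<^sup>t\<close> has entry 1 at \<open>(i, j)\<close>.\<close>

definition graphs_pmf ::
  "nat \<Rightarrow> nat \<Rightarrow> real ^ 'q ^ 'q::finite \<Rightarrow> (nat \<Rightarrow> nat \<Rightarrow> 'q) \<Rightarrow> (nat \<Rightarrow> nat \<Rightarrow> nat \<Rightarrow> bool) pmf" where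
  "graphs_pmf n T \<pi> z =
     map_pmf adjacency
       (Pi_pmf (edge_indices n T) False (\<lambda>(t, i, j). bernoulli_pmf (\<pi> $ z i t $ z j t)))"

definition dsbm_pmf ::
  "nat \<Rightarrow> nat \<Rightarrow> real ^ 'q ^ 'q \<Rightarrow> real ^ 'q ^ 'q::finite
    \<Rightarrow> ((nat \<Rightarrow> nat \<Rightarrow> 'q) \<times> (nat \<Rightarrow> nat \<Rightarrow> nat \<Rightarrow> bool)) pmf" where
  "dsbm_pmf n T \<Gamma> \<pi> =
     bind_pmf (labels_pmf n T \<Gamma>) (\<lambda>z. map_pmf (\<lambda>x. (z, x)) (graphs_pmf n T \<pi> z))"

definition param_space ::
  "real \<Rightarrow> real \<Rightarrow> ((real ^ 'q ^ 'q) \<times> (real ^ 'q ^ 'q::finite)) set" where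
  "param_space \<delta> \<zeta> = {(\<Gamma>, \<pi>).
     stochastic_matrix \<Gamma> \<and> transpose \<pi> = \<pi> \<and>
     (\<forall>q q'. q \<noteq> q' \<longrightarrow> (\<exists>l. \<pi> $ q $ l \<noteq> \<pi> $ q' $ l)) \<and>
     (\<forall>q l. \<Gamma> $ q $ l \<in> {\<delta>..1 - \<delta>}) \<and>
     (\<forall>q l. \<pi> $ q $ l \<in> {\<zeta>..1 - \<zeta>})}"

definition normalized_loglik ::
  "nat \<Rightarrow> nat \<Rightarrow> real ^ 'q ^ 'q \<Rightarrow> real ^ 'q ^ 'q::finite \<Rightarrow> (nat \<Rightarrow> nat \<Rightarrow> nat \<Rightarrow> bool) \<Rightarrow> real" where
  "normalized_loglik n T \<Gamma> \<pi> x =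
     2 / (real n * (real n - 1) * real T) * ln (pmf (map_pmf snd (dsbm_pmf n T \<Gamma> \<pi>)) x)"

definition limit_objective_at ::
  "real ^ 'q ^ 'q \<Rightarrow> real ^ 'q ^ 'q \<Rightarrow> real ^ 'q ^ 'q \<Rightarrow> real ^ 'q ^ 'q::finite \<Rightarrow> real" where
  "limit_objective_at \<Gamma>s \<pi>s \<pi> A =
     (let \<alpha>s = stationary_distribution \<Gamma>s in
      \<Sum>q\<in>UNIV. \<Sum>l\<in>UNIV. \<alpha>s $ q * \<alpha>s $ l *
        (\<Sum>q'\<in>UNIV. \<Sum>l'\<in>UNIV. A $ q $ q' * A $ l $ l' *
          (\<pi>s $ q $ l * ln (\<pi> $ q' $ l') + (1 - \<pi>s $ q $ l) * ln (1 - \<pi> $ q' $ l'))))"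

text \<open>
  For \<open>\<pi>\<close> with entries in \<open>[\<zeta>, 1 - \<zeta>]\<close> this is a supremum of a continuous function over a nonempty
  compact set, so the conditionally complete supremum on the reals is the intended one.
\<close>

definition limit_objective ::
  "real ^ 'q ^ 'q \<Rightarrow> real ^ 'q ^ 'q \<Rightarrow> real ^ 'q ^ 'q::finite \<Rightarrow> real" where
  "limit_objective \<Gamma>s \<pi>s \<pi> = (SUP A\<in>{A. stochastic_matrix A}. limit_objective_at \<Gamma>s \<pi>s \<pi> A)"

text \<open>
  On \<open>param_space \<delta> \<zeta>\<close> with \<open>0 < \<zeta> < 1/2\<close>, both the normalized log-likelihood and the limit
  objective take values in \<open>[ln \<zeta>, 0]\<close> for \<open>n \<ge> 2\<close>, \<open>T \<ge> 1\<close>, so this real supremum is over a bounded set.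
\<close>

definition uniform_deviation ::
  "real \<Rightarrow> real \<Rightarrow> nat \<Rightarrow> nat \<Rightarrow> real ^ 'q ^ 'q \<Rightarrow> real ^ 'q ^ 'q::finite
    \<Rightarrow> (nat \<Rightarrow> nat \<Rightarrow> nat \<Rightarrow> bool) \<Rightarrow> real" where
  "uniform_deviation \<delta> \<zeta> n T \<Gamma>s \<pi>s x =
     (SUP (\<Gamma>, \<pi>)\<in>param_space \<delta> \<zeta>. \<bar>normalized_loglik n T \<Gamma> \<pi> x - limit_objective \<Gamma>s \<pi>s \<pi>\<bar>)"

end

theory Submission
  imports Defs
begin

text \<open>
  Write \<open>N = n (n - 1) T / 2\<close> for the number of observed edges and \<open>C = - ln \<zeta>\<close>, which bounds every
  \<open>\<bar>ln \<pi>\<^sub>q\<^sub>l\<bar>\<close> and \<open>\<bar>ln (1 - \<pi>\<^sub>q\<^sub>l)\<bar>\<close>. Multiplied by \<open>N\<close>, the normalized log-likelihood is the logarithm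
  of the sum, over all label configurations \<open>z\<close>, of the prior weight of \<open>z\<close> times \<open>exp (L z)\<close>, where \<open>L\<close> is
  the complete-data log-likelihood. Four comparisons, each of relative size at most of order
  \<open>1 / sqrt n\<close> up to the divergent factor, lead from there to the limit objective.

  \<^item> The sum is at most the maximum of \<open>exp (L z)\<close>, and at least any one of its terms, whose prior
    weight is no less than \<open>\<delta>\<close> to the power \<open>n T\<close>. So the log-likelihood is the maximum of \<open>L\<close> up to \<open>O(n T)\<close>,
    whatever \<open>\<Gamma>\<close> is (lemma \<open>ln_observed_graph_bounds\<close>).

  \<^item> Given the true labels, \<open>L z\<close> may be replaced by its conditional mean. The difference is linear in
    the logarithms of \<open>\<pi>\<close>, with coefficients that are centred edge counts between the classes of \<open>z\<close>;
    this makes the bound uniform in \<open>\<pi>\<close>. Hoeffding's inequality for one \<open>z\<close> has exponent of order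
    \<open>r\<^sup>2 n T\<close> at deviation \<open>N r / sqrt n\<close>, which beats the number \<open>Q\<close> to the power \<open>n T\<close> of configurations as soon
    as \<open>r\<close> is large (lemma \<open>edge_excess_tail\<close>).

  \<^item> At each time the conditional mean depends on \<open>z\<close> only through the joint counts of true and
    assigned labels. Dividing these by the counts of the true labels gives a stochastic matrix \<open>A\<close>,
    so no \<open>z\<close> does better than the best \<open>A\<close>, up to diagonal terms. Conversely, drawing the assigned label of each node
    independently from the row of \<open>A\<close> that belongs to its true label attains the value of \<open>A\<close> on
    average over distinct pairs, hence some \<open>z\<close> attains at least this value; no rounding is involved
    (lemma \<open>expected_loglik_near_limit\<close>).

  \<^item> The label frequencies at each time may be replaced by the stationary distribution. Their mean
    absolute error is at most \<open>1 / sqrt n\<close>, and Markov's inequality applied to the average over time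
    controls all times together (lemma \<open>label_discrepancy_tail\<close>).

  The resulting bound on the probability at threshold \<open>\<epsilon> r / sqrt n\<close> is a multiple of \<open>1 / r\<close> plus a
  multiple of \<open>exp (- n)\<close> (lemma \<open>uniform_deviation_tail_rate\<close>).
\<close>

section \<open>Stationary distributions of positive stochastic matrices\<close>

lemma pmf_vec_pmf:
  assumes "stochastic_vector v"
  shows "pmf (vec_pmf v) q = v $ q"
proof -
  have "(\<integral>\<^sup>+ x. ennreal (v $ x) \<partial>count_space UNIV) = 1"
    using assms unfolding stochastic_vector_def
    by (simp add: nn_integral_count_space_finite sum_ennreal)
  then show ?thesis
    using assms unfolding vec_pmf_def stochastic_vector_def by (subst pmf_embed_pmf) auto
qed

lemma vector_matrix_mult_component:
  fixes G :: "real ^ 'q ^ 'q::finite"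
  shows "(d v* G) $ l = (\<Sum>q\<in>UNIV. d $ q * G $ q $ l)"
  by (simp add: vector_matrix_mult_def mult.commute)

text \<open>
  A vector of zero sum does not see a constant that is subtracted from all entries of the matrix.
  Subtracting \<open>\<delta>\<close> leaves a nonnegative matrix with row sums \<open>1 - Q \<delta>\<close>.
\<close>

lemma stochastic_matrix_contracts_l1:
  fixes G :: "real ^ 'q ^ 'q::finite"
  assumes G: "stochastic_matrix G" "\<And>q l. \<delta> \<le> G $ q $ l"
    and d: "(\<Sum>q\<in>UNIV. d $ q) = 0"
  shows "(\<Sum>l\<in>UNIV. \<bar>(d v* G) $ l\<bar>) \<le> (1 - real CARD('q) * \<delta>) * (\<Sum>q\<in>UNIV. \<bar>d $ q\<bar>)"
proof -
  have "(\<Sum>l\<in>UNIV. \<bar>(d v* G) $ l\<bar>) = (\<Sum>l\<in>UNIV. \<bar>\<Sum>q\<in>UNIV. d $ q * (G $ q $ l - \<delta>)\<bar>)"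
    using d by (simp add: vector_matrix_mult_component right_diff_distrib sum_subtractf
        sum_distrib_right[symmetric])
  also have "\<dots> \<le> (\<Sum>l\<in>UNIV. \<Sum>q\<in>UNIV. \<bar>d $ q\<bar> * (G $ q $ l - \<delta>))"
    using G(2) by (intro sum_mono order.trans[OF sum_abs] eq_refl sum.cong)
      (auto simp: abs_mult)
  also have "\<dots> = (\<Sum>q\<in>UNIV. \<bar>d $ q\<bar> * (\<Sum>l\<in>UNIV. G $ q $ l - \<delta>))"
    by (subst sum.swap) (simp add: sum_distrib_left)
  also have "\<dots> = (1 - real CARD('q) * \<delta>) * (\<Sum>q\<in>UNIV. \<bar>d $ q\<bar>)"
    using G(1) by (simp add: sum_subtractf stochastic_matrix_def stochastic_vector_def
        sum_distrib_left mult.commute)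
  finally show ?thesis .
qed

lemma stochastic_vector_mult:
  fixes G :: "real ^ 'q ^ 'q::finite"
  assumes "stochastic_matrix G" "stochastic_vector v"
  shows "stochastic_vector (v v* G)"
proof -
  have "(\<Sum>l\<in>UNIV. \<Sum>q\<in>UNIV. v $ q * G $ q $ l) = (\<Sum>q\<in>UNIV. v $ q * (\<Sum>l\<in>UNIV. G $ q $ l))"
    by (subst sum.swap) (simp add: sum_distrib_left)
  then show ?thesis
    using assms by (auto simp: stochastic_matrix_def stochastic_vector_def
        vector_matrix_mult_component intro!: sum_nonneg)
qed

lemma stochastic_vector_vertex: "stochastic_vector (axis q 1 :: real ^ 'q::finite)"
  by (auto simp: stochastic_vector_def axis_def)

lemma compact_stochastic_vectors: "compact {v :: real ^ 'q::finite. stochastic_vector v}"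
proof -
  have "closed ({v :: real ^ 'q. \<forall>q. 0 \<le> v $ q} \<inter> {v. (\<Sum>q\<in>UNIV. v $ q) = 1})"
    by (intro closed_Int closed_Collect_all closed_Collect_le closed_Collect_eq continuous_intros)
  moreover have "norm v \<le> 1" if "stochastic_vector v" for v :: "real ^ 'q"
    using norm_le_l1_cart[of v] that by (simp add: stochastic_vector_def)
  then have "bounded {v :: real ^ 'q. stochastic_vector v}"
    by (auto simp: bounded_iff)
  ultimately show ?thesis
    by (simp add: compact_eq_bounded_closed stochastic_vector_def Collect_conj_eq)
qed

lemma convex_stochastic_vectors: "convex {v :: real ^ 'q::finite. stochastic_vector v}"
  by (auto simp: convex_def stochastic_vector_def sum.distrib sum_distrib_left[symmetric])

text \<open>
  Existence is Brouwer's theorem on the simplex; uniqueness, which the definite description needs,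
  is the \<open>l\<^sup>1\<close> contraction applied to the difference of two fixed points.
\<close>

lemma stationary_distribution_is_stationary:
  fixes G :: "real ^ 'q ^ 'q::finite"
  assumes G: "stochastic_matrix G" "\<And>q l. \<delta> \<le> G $ q $ l" and "0 < \<delta>"
  shows "stochastic_vector (stationary_distribution G)"
    and "stationary_distribution G v* G = stationary_distribution G"
proof -
  let ?S = "{v :: real ^ 'q. stochastic_vector v}"
  have cont: "continuous_on ?S (\<lambda>v. v v* G)"
    unfolding vector_matrix_mult_def by (intro continuous_intros)
  have "?S \<noteq> {}" "(\<lambda>v. v v* G) \<in> ?S \<rightarrow> ?S"
    using stochastic_vector_vertex stochastic_vector_mult[OF G(1)] by auto
  then obtain a where a: "stochastic_vector a" "a v* G = a"
    using brouwer[OF compact_stochastic_vectors convex_stochastic_vectors _ cont] by auto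
  have unique: "b = a" if b: "stochastic_vector b" "b v* G = b" for b
  proof -
    let ?s = "\<Sum>q\<in>UNIV. \<bar>(b - a) $ q\<bar>"
    have "(\<Sum>q\<in>UNIV. (b - a) $ q) = 0"
      using a b by (simp add: stochastic_vector_def sum_subtractf)
    from stochastic_matrix_contracts_l1[OF G this]
    have "?s \<le> (1 - real CARD('q) * \<delta>) * ?s"
      using a b by (simp add: vector_matrix_mult_component left_diff_distrib sum_subtractf vec_eq_iff)
    then have "(real CARD('q) * \<delta>) * ?s \<le> 0"
      by (simp add: algebra_simps)
    then have "?s \<le> 0"
      using \<open>0 < \<delta>\<close> by (simp add: mult_le_0_iff)
    then have "?s = 0"
      by (simp add: sum_nonneg order.antisym)
    then show ?thesis
      by (simp add: sum_nonneg_eq_0_iff vec_eq_iff)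
  qed
  have "stochastic_vector (stationary_distribution G) \<and>
      stationary_distribution G v* G = stationary_distribution G"
    unfolding stationary_distribution_def
  proof (rule theI[of _ a])
    show "stochastic_vector a \<and> a v* G = a" using a by (rule conjI)
    show "b = a" if "stochastic_vector b \<and> b v* G = b" for b
      using that by (elim conjE) (rule unique)
  qed
  then show "stochastic_vector (stationary_distribution G)"
    and "stationary_distribution G v* G = stationary_distribution G" by auto
qed

text \<open>
  Each entry is an average of a column of the matrix, so the lower bound on the matrix is inherited;
  it makes the initial label cost no more than a transition.
\<close>

lemma stationary_distribution_ge:
  fixes G :: "real ^ 'q ^ 'q::finite"
  assumes G: "stochastic_matrix G" "\<And>q l. \<delta> \<le> G $ q $ l" and "0 < \<delta>"
  shows "\<delta> \<le> stationary_distribution G $ q"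
proof -
  let ?a = "stationary_distribution G"
  note a = stationary_distribution_is_stationary[OF G \<open>0 < \<delta>\<close>]
  have "\<delta> = (\<Sum>l\<in>UNIV. ?a $ l * \<delta>)"
    using a(1) by (simp add: stochastic_vector_def sum_distrib_right[symmetric])
  also have "\<dots> \<le> (\<Sum>l\<in>UNIV. ?a $ l * G $ l $ q)"
    using a(1) G(2) by (intro sum_mono mult_left_mono) (auto simp: stochastic_vector_def)
  also have "\<dots> = ?a $ q"
    using a(2) by (metis vector_matrix_mult_component)
  finally show ?thesis .
qed

section \<open>Marginals and path probabilities of the label chain\<close>

text \<open>
  In the induction only the last time needs stationarity: its marginal is the previous marginal
  multiplied by the transition matrix.
\<close>

lemma markov_chain_marginal:
  fixes G :: "real ^ 'q ^ 'q::finite"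
  assumes G: "stochastic_matrix G" and a: "stochastic_vector a" "a v* G = a"
    and "t \<in> {1..T}"
  shows "map_pmf (\<lambda>z. z t) (markov_chain_pmf a G T) = vec_pmf a"
  using \<open>t \<in> {1..T}\<close>
proof (induction T arbitrary: t)
  case 0
  then show ?case by simp
next
  case (Suc T)
  show ?case
  proof (cases "t = Suc T")
    case False
    then have "map_pmf (\<lambda>z. z t) (markov_chain_pmf a G (Suc T))
        = bind_pmf (markov_chain_pmf a G T) (\<lambda>z. return_pmf (z t))"
      by (simp add: map_bind_pmf pmf.map_comp o_def map_pmf_const)
    also have "\<dots> = map_pmf (\<lambda>z. z t) (markov_chain_pmf a G T)"
      by (simp only: map_pmf_def)
    also have "\<dots> = vec_pmf a"
      using False Suc.prems by (intro Suc.IH) auto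
    finally show ?thesis .
  next
    case True
    show ?thesis
    proof (cases "T = 0")
      case True
      then show ?thesis
        using \<open>t = Suc T\<close> by (simp add: bind_return_pmf pmf.map_comp o_def)
    next
      case False
      have "map_pmf (\<lambda>z. z t) (markov_chain_pmf a G (Suc T))
          = bind_pmf (markov_chain_pmf a G T) (\<lambda>z. vec_pmf (G $ z T))"
        using False \<open>t = Suc T\<close> by (simp add: map_bind_pmf pmf.map_comp o_def)
      also have "\<dots> = bind_pmf (map_pmf (\<lambda>z. z T) (markov_chain_pmf a G T)) (\<lambda>q. vec_pmf (G $ q))"
        by (simp add: bind_map_pmf)
      also have "map_pmf (\<lambda>z. z T) (markov_chain_pmf a G T) = vec_pmf a"
        using False by (intro Suc.IH) auto
      also have "bind_pmf (vec_pmf a) (\<lambda>q. vec_pmf (G $ q)) = vec_pmf a"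
      proof (rule pmf_eqI)
        fix l
        have "pmf (bind_pmf (vec_pmf a) (\<lambda>q. vec_pmf (G $ q))) l = (a v* G) $ l"
          using G a(1)
          by (simp add: pmf_bind integral_measure_pmf_real[of UNIV] pmf_vec_pmf
              stochastic_matrix_def vector_matrix_mult_component mult.commute)
        then show "pmf (bind_pmf (vec_pmf a) (\<lambda>q. vec_pmf (G $ q))) l = pmf (vec_pmf a) l"
          by (simp add: a pmf_vec_pmf)
      qed
      finally show ?thesis .
    qed
  qed
qed

text \<open>
  Keeping a single term of the mixture. It serves both for one more step of the chain and for one
  label configuration in the likelihood of the graph.
\<close>

lemma pmf_bind_ge: "pmf M y * pmf (f y) x \<le> pmf (bind_pmf M f) x"
proof -
  have "pmf M y * pmf (f y) x = (\<integral>u. indicator {y} u * pmf (f y) x \<partial>M)"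
    by (simp add: measure_pmf_single)
  also have "\<dots> \<le> (\<integral>u. pmf (f u) x \<partial>M)"
    by (intro integral_mono measure_pmf.integrable_const_bound[where B = 1])
      (auto simp: indicator_def pmf_le_1)
  finally show ?thesis by (simp add: pmf_bind)
qed

lemma markov_chain_pmf_ge:
  fixes G :: "real ^ 'q ^ 'q::finite"
  assumes G: "stochastic_matrix G" "\<And>q l. \<delta> \<le> G $ q $ l"
    and a: "stochastic_vector a" "\<And>q. \<delta> \<le> a $ q" and "0 \<le> \<delta>"
    and "\<And>t. t \<notin> {1..T} \<Longrightarrow> z t = undefined"
  shows "\<delta> ^ T \<le> pmf (markov_chain_pmf a G T) z"
  using assms(6)
proof (induction T arbitrary: z)
  case 0
  then have "z = (\<lambda>_. undefined)" by auto
  then show ?case by simp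
next
  case (Suc T)
  let ?z = "z(Suc T := undefined)"
  let ?step = "\<lambda>y. map_pmf (\<lambda>q. y(Suc T := q)) (vec_pmf (if T = 0 then a else G $ y T))"
  have "\<delta> ^ T \<le> pmf (markov_chain_pmf a G T) ?z"
    using Suc.prems by (intro Suc.IH) auto
  moreover have "\<delta> \<le> pmf (?step ?z) z"
  proof -
    have "pmf (?step ?z) (?z(Suc T := z (Suc T))) = pmf (vec_pmf (if T = 0 then a else G $ ?z T)) (z (Suc T))"
      by (rule pmf_map_inj') (auto simp: inj_def dest: fun_upd_eqD)
    then show ?thesis
      using G a by (auto simp: pmf_vec_pmf stochastic_matrix_def split: if_splits)
  qed
  ultimately have "\<delta> ^ T * \<delta> \<le> pmf (markov_chain_pmf a G T) ?z * pmf (?step ?z) z"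
    using \<open>0 \<le> \<delta>\<close> by (intro mult_mono) simp_all
  also have "\<dots> \<le> pmf (bind_pmf (markov_chain_pmf a G T) ?step) z"
    by (rule pmf_bind_ge)
  also have "\<dots> = pmf (markov_chain_pmf a G (Suc T)) z"
    by simp
  finally show ?case by (simp only: power_Suc2)
qed

section \<open>Independent families: pairs of components and concentration\<close>

lemma Pi_pmf_two_components:
  assumes "finite I" "i \<in> I" "j \<in> I" "i \<noteq> j"
  shows "map_pmf (\<lambda>f. (f i, f j)) (Pi_pmf I d p) = pair_pmf (p i) (p j)"
proof -
  have "Pi_pmf I d p = map_pmf (\<lambda>(y, f). f(i := y)) (pair_pmf (p i) (Pi_pmf (I - {i}) d p))"
    using assms Pi_pmf_insert[of "I - {i}" i d p] by (simp add: insert_absorb)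
  then have "map_pmf (\<lambda>f. (f i, f j)) (Pi_pmf I d p)
      = map_pmf (apsnd (\<lambda>f. f j)) (pair_pmf (p i) (Pi_pmf (I - {i}) d p))"
    using assms by (auto simp: pmf.map_comp o_def intro!: map_pmf_cong)
  also have "\<dots> = pair_pmf (p i) (map_pmf (\<lambda>f. f j) (Pi_pmf (I - {i}) d p))"
    by (simp only: pair_map_pmf2)
  also have "map_pmf (\<lambda>f. f j) (Pi_pmf (I - {i}) d p) = p j"
    using assms by (subst Pi_pmf_component) auto
  finally show ?thesis .
qed

lemma expectation_Pi_vec_pmf_two_components:
  fixes h :: "'q::finite \<Rightarrow> 'q \<Rightarrow> real"
  assumes "finite I" "i \<in> I" "j \<in> I" "i \<noteq> j" "stochastic_vector (v i)" "stochastic_vector (v j)"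
  shows "measure_pmf.expectation (Pi_pmf I d (\<lambda>i. vec_pmf (v i))) (\<lambda>f. h (f i) (f j))
    = (\<Sum>q\<in>UNIV. \<Sum>l\<in>UNIV. v i $ q * v j $ l * h q l)"
proof -
  have "measure_pmf.expectation (Pi_pmf I d (\<lambda>i. vec_pmf (v i))) (\<lambda>f. h (f i) (f j))
      = measure_pmf.expectation (pair_pmf (vec_pmf (v i)) (vec_pmf (v j))) (\<lambda>x. h (fst x) (snd x))"
    using integral_map_pmf[of "\<lambda>f. (f i, f j)" "Pi_pmf I d (\<lambda>i. vec_pmf (v i))" "\<lambda>x. h (fst x) (snd x)"]
    by (simp add: Pi_pmf_two_components assms(1-4))
  also have "\<dots> = (\<Sum>x\<in>UNIV \<times> UNIV. h (fst x) (snd x) * pmf (pair_pmf (vec_pmf (v i)) (vec_pmf (v j))) x)"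
    by (rule integral_measure_pmf_real) auto
  also have "\<dots> = (\<Sum>q\<in>UNIV. \<Sum>l\<in>UNIV. v i $ q * v j $ l * h q l)"
    by (auto simp: sum.cartesian_product pmf_pair pmf_vec_pmf assms mult.commute intro!: sum.cong)
  finally show ?thesis .
qed

lemma finite_set_Pi_pmf:
  fixes p :: "'i \<Rightarrow> 'q::finite pmf"
  assumes "finite I"
  shows "finite (set_pmf (Pi_pmf I d p))"
  by (rule finite_subset[OF set_Pi_pmf_subset'[OF assms]]) (use assms in auto)

text \<open>
  Hoeffding's inequality for the sum over a subset \<open>S\<close>. The variables off \<open>S\<close> are set to \<open>0\<close> rather than
  removed, so that the exponent involves \<open>card E\<close> for every \<open>S\<close>, including the empty one.
\<close>

lemma Pi_bernoulli_concentration: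
  assumes E: "finite E" "E \<noteq> {}" "S \<subseteq> E" and p: "\<And>e. e \<in> E \<Longrightarrow> p e \<in> {0..1}" and "0 \<le> s"
  shows "measure_pmf.prob (Pi_pmf E False (\<lambda>e. bernoulli_pmf (p e)))
      {x. s \<le> \<bar>\<Sum>e\<in>S. of_bool (x e) - p e\<bar>} \<le> 2 * exp (- 2 * s\<^sup>2 / real (card E))"
proof -
  let ?P = "Pi_pmf E False (\<lambda>e. bernoulli_pmf (p e))"
  let ?X = "\<lambda>e x. of_bool (e \<in> S \<and> x e) :: real"
  have "prob_space.indep_vars ?P (\<lambda>_. borel) ?X E"
    by (rule prob_space.indep_vars_compose2[OF measure_pmf.prob_space_axioms
          indep_vars_Pi_pmf[OF E(1)], where Y = "\<lambda>e b. of_bool (e \<in> S \<and> b)"]) auto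
  then interpret Hoeffding_ineq ?P E ?X "\<lambda>_. 0" "\<lambda>_. 1" "\<Sum>e\<in>E. measure_pmf.expectation ?P (?X e)"
    by unfold_locales (use E in auto)
  have mean: "measure_pmf.expectation ?P (?X e) = (if e \<in> S then p e else 0)" if "e \<in> E" for e
    using integral_map_pmf[of "\<lambda>f. f e" ?P "of_bool :: bool \<Rightarrow> real"] that p[OF that] E(1)
    by (auto simp: Pi_pmf_component)
  have dev: "(\<Sum>e\<in>E. ?X e x) - (\<Sum>e\<in>E. measure_pmf.expectation ?P (?X e))
      = (\<Sum>e\<in>S. of_bool (x e) - p e)" for x
  proof -
    have "(\<Sum>e\<in>E. ?X e x) - (\<Sum>e\<in>E. measure_pmf.expectation ?P (?X e))
      = (\<Sum>e\<in>E. if e \<in> S then of_bool (x e) - p e else 0)"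
      unfolding sum_subtractf[symmetric] by (intro sum.cong) (auto simp: mean)
    also have "\<dots> = (\<Sum>e\<in>S. of_bool (x e) - p e)"
      using E by (simp add: sum.inter_restrict[symmetric] Int_absorb1)
    finally show ?thesis .
  qed
  have "0 < (\<Sum>e\<in>E. (1 - 0 :: real)\<^sup>2)"
    using E by (simp add: card_gt_0_iff)
  from Hoeffding_ineq_abs_ge[OF \<open>0 \<le> s\<close> this] show ?thesis
    by (simp only: dev) simp
qed

section \<open>The observed likelihood and the complete-data likelihood\<close>

definition upper_pairs :: "nat \<Rightarrow> (nat \<times> nat) set" where
  "upper_pairs n = {(i, j). i \<in> {1..n} \<and> j \<in> {1..n} \<and> i < j}"

lemma finite_upper_pairs [simp]: "finite (upper_pairs n)"
  by (rule finite_subset[of _ "{1..n} \<times> {1..n}"]) (auto simp: upper_pairs_def)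

lemma edge_indices_eq: "edge_indices n T = {1..T} \<times> upper_pairs n"
  by (auto simp: edge_indices_def upper_pairs_def)

lemma finite_edge_indices [simp]: "finite (edge_indices n T)"
  by (simp add: edge_indices_eq)

lemma sum_edge_indices:
  "(\<Sum>(t, i, j)\<in>edge_indices n T. h t i j) = (\<Sum>t\<in>{1..T}. \<Sum>(i, j)\<in>upper_pairs n. h t i j)"
  unfolding edge_indices_eq by (subst sum.cartesian_product) (simp add: case_prod_beta)

definition complete_loglik ::
  "nat \<Rightarrow> nat \<Rightarrow> real ^ 'q ^ 'q::finite \<Rightarrow> (nat \<times> nat \<times> nat \<Rightarrow> bool) \<Rightarrow> (nat \<Rightarrow> nat \<Rightarrow> 'q) \<Rightarrow> real" where
  "complete_loglik n T \<pi> e z = (\<Sum>(t, i, j)\<in>edge_indices n T.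
     if e (t, i, j) then ln (\<pi> $ z i t $ z j t) else ln (1 - \<pi> $ z i t $ z j t))"

text \<open>
  Only entries with \<open>i < j\<close> are read off by \<^const>\<open>adjacency\<close>; edge configurations that vanish off the edge
  indices are therefore recovered from the matrix.
\<close>

lemma inj_on_adjacency:
  "inj_on adjacency {e. \<forall>k. k \<notin> edge_indices n T \<longrightarrow> \<not> e k}"
proof (rule inj_onI, rule ext)
  fix e e' :: "nat \<times> nat \<times> nat \<Rightarrow> bool" and k :: "nat \<times> nat \<times> nat"
  assume e: "e \<in> {e. \<forall>k. k \<notin> edge_indices n T \<longrightarrow> \<not> e k}"
    "e' \<in> {e. \<forall>k. k \<notin> edge_indices n T \<longrightarrow> \<not> e k}" "adjacency e = adjacency e'"
  obtain t i j where k: "k = (t, i, j)" by (cases k) auto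
  show "e k = e' k"
  proof (cases "i < j")
    case True
    then show ?thesis
      using fun_cong[OF fun_cong[OF fun_cong[OF e(3), of t], of i], of j] by (simp add: k adjacency_def)
  next
    case False
    then show ?thesis using e by (simp add: k edge_indices_def)
  qed
qed

lemma pmf_graphs:
  assumes \<pi>: "\<And>q l. 0 < \<pi> $ q $ l" "\<And>q l. \<pi> $ q $ l < 1"
    and e: "\<forall>k. k \<notin> edge_indices n T \<longrightarrow> \<not> e k"
  shows "pmf (graphs_pmf n T \<pi> z) (adjacency e) = exp (complete_loglik n T \<pi> e z)"
proof -
  let ?P = "Pi_pmf (edge_indices n T) False (\<lambda>(t, i, j). bernoulli_pmf (\<pi> $ z i t $ z j t))"
  have eq: "pmf ?P e = exp (complete_loglik n T \<pi> e z)"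
    unfolding complete_loglik_def using e \<pi>
    by (subst pmf_Pi') (auto simp: exp_sum less_imp_le intro!: prod.cong)
  have "pmf (map_pmf adjacency ?P) (adjacency e) = pmf ?P e"
  proof (rule pmf_map_inj)
    show "inj_on adjacency (set_pmf ?P)"
      by (rule inj_on_subset[OF inj_on_adjacency]) (rule set_Pi_pmf_subset[where dflt = False, simplified], simp)
    show "e \<in> set_pmf ?P"
      using eq by (simp add: set_pmf_iff)
  qed
  with eq show ?thesis by (simp add: graphs_pmf_def)
qed

lemma observed_graph_pmf:
  "map_pmf snd (dsbm_pmf n T \<Gamma> \<pi>) = bind_pmf (labels_pmf n T \<Gamma>) (graphs_pmf n T \<pi>)"
  by (simp add: dsbm_pmf_def map_bind_pmf pmf.map_comp o_def)

text \<open>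
  The observed likelihood is a mixture of \<open>exp (complete_loglik z)\<close> over \<open>z\<close>. An upper bound for all of
  the exponents passes to the mixture; a lower bound comes from one \<open>z\<close>, which every node's chain
  follows with probability at least \<open>\<delta> ^ T\<close>. The bounds do not involve \<open>\<Gamma>\<close> beyond \<open>\<delta>\<close>, which gives
  uniformity in \<open>\<Gamma>\<close>.
\<close>

lemma ln_observed_graph_bounds:
  fixes \<Gamma> \<pi> :: "real ^ 'q ^ 'q::finite"
  assumes G: "stochastic_matrix \<Gamma>" "\<And>q l. \<delta> \<le> \<Gamma> $ q $ l" and "0 < \<delta>"
    and \<pi>: "\<And>q l. 0 < \<pi> $ q $ l" "\<And>q l. \<pi> $ q $ l < 1"
    and e: "\<forall>k. k \<notin> edge_indices n T \<longrightarrow> \<not> e k"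
  defines "L \<equiv> ln (pmf (map_pmf snd (dsbm_pmf n T \<Gamma> \<pi>)) (adjacency e))"
  shows "real n * real T * ln \<delta> + complete_loglik n T \<pi> e z \<le> L"
    and "(\<And>z. complete_loglik n T \<pi> e z \<le> B) \<Longrightarrow> L \<le> B"
proof -
  let ?p = "pmf (map_pmf snd (dsbm_pmf n T \<Gamma> \<pi>)) (adjacency e)"
  have lower: "exp (real n * real T * ln \<delta> + complete_loglik n T \<pi> e z) \<le> ?p" for z
  proof -
    \<comment> \<open>Outside the observed nodes and times the labels must take the default values, as
      otherwise their weight is \<open>0\<close>.\<close>
    define z' where "z' = (\<lambda>i. if i \<in> {1..n} then \<lambda>t. if t \<in> {1..T} then z i t else undefined
      else (\<lambda>_. undefined))"
    note a = stationary_distribution_is_stationary(1)[OF G \<open>0 < \<delta>\<close>]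
      stationary_distribution_ge[OF G \<open>0 < \<delta>\<close>]
    have "(\<delta> ^ T) ^ n = (\<Prod>i\<in>{1..n}. \<delta> ^ T)" by simp
    also have "\<dots> \<le> (\<Prod>i\<in>{1..n}. pmf (markov_chain_pmf (stationary_distribution \<Gamma>) \<Gamma> T) (z' i))"
      using G a \<open>0 < \<delta>\<close>
      by (intro prod_mono conjI markov_chain_pmf_ge[where \<delta> = \<delta>]) (auto simp: z'_def)
    also have "\<dots> = pmf (labels_pmf n T \<Gamma>) z'"
      unfolding labels_pmf_def by (subst pmf_Pi') (auto simp: z'_def)
    finally have labels: "(\<delta> ^ T) ^ n \<le> pmf (labels_pmf n T \<Gamma>) z'" .
    have "complete_loglik n T \<pi> e z' = complete_loglik n T \<pi> e z"
      unfolding complete_loglik_def by (intro sum.cong refl) (auto simp: edge_indices_def z'_def)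
    then have "exp (real n * real T * ln \<delta> + complete_loglik n T \<pi> e z)
        = (\<delta> ^ T) ^ n * pmf (graphs_pmf n T \<pi> z') (adjacency e)"
      using \<open>0 < \<delta>\<close> e
      by (simp add: exp_add pmf_graphs[OF \<pi>] exp_of_nat_mult mult.assoc flip: power_mult)
    also have "\<dots> \<le> pmf (labels_pmf n T \<Gamma>) z' * pmf (graphs_pmf n T \<pi> z') (adjacency e)"
      using labels by (rule mult_right_mono) simp
    also have "\<dots> \<le> ?p"
      unfolding observed_graph_pmf by (rule pmf_bind_ge)
    finally show ?thesis .
  qed
  have pos: "0 < ?p"
    using lower[of "\<lambda>_ _. undefined"] by (rule less_le_trans[rotated]) simp
  show "real n * real T * ln \<delta> + complete_loglik n T \<pi> e z \<le> L"
    using lower[of z] pos by (simp add: L_def ln_ge_iff)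
  show "L \<le> B" if B: "\<And>z. complete_loglik n T \<pi> e z \<le> B"
  proof -
    have "?p = (\<integral>z. exp (complete_loglik n T \<pi> e z) \<partial>labels_pmf n T \<Gamma>)"
      using e by (simp add: observed_graph_pmf pmf_bind pmf_graphs[OF \<pi>])
    also have "\<dots> \<le> exp B"
      by (rule measure_pmf.integral_le_const)
        (auto intro!: measure_pmf.integrable_const_bound[where B = "exp B"] B)
    finally have "ln ?p \<le> ln (exp B)"
      using pos by (subst ln_le_cancel_iff) auto
    then show ?thesis by (simp add: L_def)
  qed
qed

section \<open>Label frequencies and quadratic forms at a single time\<close>

definition label_freq :: "nat \<Rightarrow> (nat \<Rightarrow> 'q) \<Rightarrow> 'q \<Rightarrow> real" where
  "label_freq n a q = real (card {i \<in> {1..n}. a i = q}) / real n"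

definition pair_mean :: "('q::finite \<Rightarrow> real) \<Rightarrow> ('q \<Rightarrow> 'q \<Rightarrow> real) \<Rightarrow> real" where
  "pair_mean v g = (\<Sum>q\<in>UNIV. \<Sum>l\<in>UNIV. v q * v l * g q l)"

text \<open>
  The mean of \<open>F q l q' l'\<close> when \<open>q'\<close> and \<open>l'\<close> are drawn independently from the rows \<open>q\<close> and \<open>l\<close> of \<open>A\<close>. With the
  conditional log-likelihood of an edge as \<open>F\<close>, its \<open>pair_mean\<close> under the stationary distribution is
  the limit objective at \<open>A\<close>.
\<close>

definition relabelled_mean ::
  "real ^ 'q ^ 'q::finite \<Rightarrow> ('q \<Rightarrow> 'q \<Rightarrow> 'q \<Rightarrow> 'q \<Rightarrow> real) \<Rightarrow> 'q \<Rightarrow> 'q \<Rightarrow> real" where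
  "relabelled_mean A F q l = (\<Sum>q'\<in>UNIV. \<Sum>l'\<in>UNIV. A $ q $ q' * A $ l $ l' * F q l q' l')"

lemma sum_labels_eq_freq:
  fixes a :: "nat \<Rightarrow> 'q::finite"
  assumes "1 \<le> n"
  shows "(\<Sum>i\<in>{1..n}. h (a i)) = real n * (\<Sum>q\<in>UNIV. label_freq n a q * h q)"
proof -
  have "(\<Sum>i\<in>{1..n}. h (a i)) = (\<Sum>q\<in>UNIV. \<Sum>i\<in>{i \<in> {1..n}. a i = q}. h (a i))"
    by (rule sum.group[symmetric]) auto
  also have "\<dots> = (\<Sum>q\<in>UNIV. real n * (label_freq n a q * h q))"
    using assms by (intro sum.cong) (auto simp: label_freq_def)
  finally show ?thesis by (simp add: sum_distrib_left)
qed

lemma label_freq_nonneg: "0 \<le> label_freq n a q"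
  by (simp add: label_freq_def)

lemma sum_label_freq:
  fixes a :: "nat \<Rightarrow> 'q::finite"
  assumes "1 \<le> n"
  shows "(\<Sum>q\<in>UNIV. label_freq n a q) = 1"
  using sum_labels_eq_freq[OF assms, of "\<lambda>_. 1" a] assms by simp

lemma sum_label_pairs_eq_pair_mean:
  fixes a :: "nat \<Rightarrow> 'q::finite"
  assumes "1 \<le> n"
  shows "(\<Sum>i\<in>{1..n}. \<Sum>j\<in>{1..n}. g (a i) (a j)) = (real n)\<^sup>2 * pair_mean (label_freq n a) g"
proof -
  have "(\<Sum>i\<in>{1..n}. \<Sum>j\<in>{1..n}. g (a i) (a j))
      = (\<Sum>i\<in>{1..n}. real n * (\<Sum>l\<in>UNIV. label_freq n a l * g (a i) l))"
    by (simp only: sum_labels_eq_freq[OF assms])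
  also have "\<dots> = real n * (\<Sum>q\<in>UNIV. label_freq n a q * (real n * (\<Sum>l\<in>UNIV. label_freq n a l * g q l)))"
    by (rule sum_labels_eq_freq[OF assms])
  finally show ?thesis
    by (simp add: pair_mean_def sum_distrib_left power2_eq_square mult_ac)
qed

text \<open>
  Edges are unordered pairs of distinct nodes, whereas the limit is a quadratic form. The diagonal,
  which has only \<open>n\<close> terms, is the whole difference.
\<close>

lemma sum_square_eq_upper_pairs:
  fixes h :: "nat \<Rightarrow> nat \<Rightarrow> real"
  assumes sym: "\<And>i j. h i j = h j i"
  shows "(\<Sum>i\<in>{1..n}. \<Sum>j\<in>{1..n}. h i j) = 2 * (\<Sum>(i, j)\<in>upper_pairs n. h i j) + (\<Sum>i\<in>{1..n}. h i i)"
proof -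
  let ?I = "{1..n}"
  have upper: "(\<Sum>(i, j)\<in>upper_pairs n. h i j) = (\<Sum>i\<in>?I. \<Sum>j\<in>?I. if i < j then h i j else 0)"
  proof -
    have "upper_pairs n = {p \<in> ?I \<times> ?I. fst p < snd p}"
      by (auto simp: upper_pairs_def)
    then have "(\<Sum>(i, j)\<in>upper_pairs n. h i j)
        = (\<Sum>p\<in>?I \<times> ?I. if fst p < snd p then h (fst p) (snd p) else 0)"
      by (simp add: sum.inter_filter case_prod_beta)
    also have "\<dots> = (\<Sum>i\<in>?I. \<Sum>j\<in>?I. if i < j then h i j else 0)"
      by (subst sum.cartesian_product) (simp add: case_prod_beta)
    finally show ?thesis .
  qed
  \<comment> \<open>The part below the diagonal is rewritten with the indices exchanged, so that swapping
    the sums turns it into the part above.\<close>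
  have "(\<Sum>i\<in>?I. \<Sum>j\<in>?I. h i j) = (\<Sum>i\<in>?I. \<Sum>j\<in>?I.
      (if i < j then h i j else 0) + (if j < i then h j i else 0) + (if i = j then h i i else 0))"
    by (intro sum.cong refl) (auto simp: sym[of _ "_ :: nat"])
  also have "\<dots> = (\<Sum>i\<in>?I. \<Sum>j\<in>?I. if i < j then h i j else 0)
      + (\<Sum>i\<in>?I. \<Sum>j\<in>?I. if j < i then h j i else 0) + (\<Sum>i\<in>?I. h i i)"
    by (simp add: sum.distrib)
  also have "(\<Sum>i\<in>?I. \<Sum>j\<in>?I. if j < i then h j i else 0) = (\<Sum>i\<in>?I. \<Sum>j\<in>?I. if i < j then h i j else 0)"
    by (rule sum.swap)
  finally show ?thesis by (simp add: upper)
qed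

lemma card_upper_pairs: "real (card (upper_pairs n)) = real n * (real n - 1) / 2"
  using sum_square_eq_upper_pairs[of "\<lambda>_ _. 1" n] by (simp add: case_prod_beta algebra_simps)

lemma abs_sum_le_of_bound:
  assumes "\<And>i. i \<in> I \<Longrightarrow> \<bar>h i :: real\<bar> \<le> C"
  shows "\<bar>\<Sum>i\<in>I. h i\<bar> \<le> real (card I) * C"
  by (rule order.trans[OF sum_abs]) (rule sum_bounded_above[OF assms])

lemma pair_mean_bound:
  assumes v: "\<And>q. 0 \<le> v q" "(\<Sum>q\<in>UNIV. v q) = 1" and g: "\<And>q l. \<bar>g q l\<bar> \<le> C"
  shows "\<bar>pair_mean v g\<bar> \<le> C"
proof -
  have "\<bar>pair_mean v g\<bar> \<le> (\<Sum>q\<in>UNIV. \<Sum>l\<in>UNIV. v q * v l * C)"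
    unfolding pair_mean_def using v g
    by (intro order.trans[OF sum_abs] sum_mono) (auto simp: abs_mult intro!: mult_left_mono)
  then show ?thesis
    using v by (simp add: sum_distrib_right[symmetric] sum_distrib_left[symmetric])
qed

lemma pair_mean_diff_le:
  assumes u: "\<And>q. 0 \<le> u q" "(\<Sum>q\<in>UNIV. u q) = 1" and v: "\<And>q. 0 \<le> v q" "(\<Sum>q\<in>UNIV. v q) = 1"
    and g: "\<And>q l. \<bar>g q l\<bar> \<le> C"
  shows "\<bar>pair_mean u g - pair_mean v g\<bar> \<le> 2 * C * (\<Sum>q\<in>UNIV. \<bar>u q - v q\<bar>)"
proof -
  have "pair_mean u g - pair_mean v g
      = (\<Sum>q\<in>UNIV. \<Sum>l\<in>UNIV. ((u q - v q) * u l + v q * (u l - v l)) * g q l)"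
    by (simp add: pair_mean_def sum_subtractf[symmetric] algebra_simps)
  also have "\<bar>\<dots>\<bar> \<le> (\<Sum>q\<in>UNIV. \<Sum>l\<in>UNIV. (\<bar>u q - v q\<bar> * u l + v q * \<bar>u l - v l\<bar>) * C)"
  proof (intro order.trans[OF sum_abs] sum_mono)
    fix q l
    have "\<bar>(u q - v q) * u l + v q * (u l - v l)\<bar> \<le> \<bar>u q - v q\<bar> * u l + v q * \<bar>u l - v l\<bar>"
      using u v by (intro order.trans[OF abs_triangle_ineq]) (simp add: abs_mult)
    then show "\<bar>((u q - v q) * u l + v q * (u l - v l)) * g q l\<bar> \<le> (\<bar>u q - v q\<bar> * u l + v q * \<bar>u l - v l\<bar>) * C"
      unfolding abs_mult using g[of q l] by (intro mult_mono) auto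
  qed
  also have "\<dots> = 2 * C * (\<Sum>q\<in>UNIV. \<bar>u q - v q\<bar>)"
    using u v by (simp add: sum_distrib_right[symmetric] sum.distrib sum_distrib_left[symmetric])
  finally show ?thesis .
qed

text \<open>
  Two errors: the frequencies \<open>label_freq n a\<close> in place of \<open>v\<close>, and the diagonal terms that separate
  the sum over pairs from the quadratic form.
\<close>

lemma slice_sum_near_pair_mean:
  fixes a :: "nat \<Rightarrow> 'q::finite"
  assumes "1 \<le> n" and v: "\<And>q. 0 \<le> v q" "(\<Sum>q\<in>UNIV. v q) = 1"
    and g: "\<And>q l. \<bar>g q l\<bar> \<le> C" "\<And>q l. g q l = g l q"
  shows "\<bar>(\<Sum>(i, j)\<in>upper_pairs n. g (a i) (a j)) - real (card (upper_pairs n)) * pair_mean v g\<bar>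
    \<le> (real n)\<^sup>2 * C * (\<Sum>q\<in>UNIV. \<bar>label_freq n a q - v q\<bar>) + real n * C"
proof -
  let ?u = "label_freq n a"
  have sq: "(real n)\<^sup>2 * pair_mean ?u g = 2 * (\<Sum>(i, j)\<in>upper_pairs n. g (a i) (a j)) + (\<Sum>i\<in>{1..n}. g (a i) (a i))"
    using sum_square_eq_upper_pairs[of "\<lambda>i j. g (a i) (a j)" n] sum_label_pairs_eq_pair_mean[OF \<open>1 \<le> n\<close>, of g a] g(2)
    by simp
  have card: "2 * (real (card (upper_pairs n)) * pair_mean v g) = (real n)\<^sup>2 * pair_mean v g - real n * pair_mean v g"
    by (simp add: card_upper_pairs field_simps power2_eq_square)
  have "\<bar>\<Sum>i\<in>{1..n}. g (a i) (a i)\<bar> \<le> real n * C"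
    using abs_sum_le_of_bound[of "{1..n}" "\<lambda>i. g (a i) (a i)" C] g(1) by simp
  moreover have "\<bar>pair_mean v g\<bar> \<le> C"
    using v g(1) by (rule pair_mean_bound)
  then have "\<bar>real n * pair_mean v g\<bar> \<le> real n * C"
    by (simp add: abs_mult mult_left_mono)
  moreover have "\<bar>(real n)\<^sup>2 * pair_mean ?u g - (real n)\<^sup>2 * pair_mean v g\<bar>
      \<le> (real n)\<^sup>2 * (2 * C * (\<Sum>q\<in>UNIV. \<bar>?u q - v q\<bar>))"
    using pair_mean_diff_le[of ?u v g C] label_freq_nonneg[of n a] sum_label_freq[OF \<open>1 \<le> n\<close>, of a] v g(1)
    by (simp add: right_diff_distrib[symmetric] abs_mult mult_left_mono)
  ultimately show ?thesis
    using sq card by (simp add: algebra_simps)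
qed

section \<open>Relabellings and stochastic matrices\<close>

lemma relabelled_mean_bound:
  assumes "stochastic_matrix A" and F: "\<And>q l q' l'. \<bar>F q l q' l'\<bar> \<le> C"
  shows "\<bar>relabelled_mean A F q l\<bar> \<le> C"
proof -
  have "\<bar>relabelled_mean A F q l\<bar> \<le> (\<Sum>q'\<in>UNIV. \<Sum>l'\<in>UNIV. A $ q $ q' * A $ l $ l' * C)"
    unfolding relabelled_mean_def using assms
    by (intro order.trans[OF sum_abs] sum_mono)
      (auto simp: abs_mult stochastic_matrix_def stochastic_vector_def intro!: mult_left_mono)
  then show ?thesis
    using assms(1) by (simp add: stochastic_matrix_def stochastic_vector_def
        sum_distrib_right[symmetric] sum_distrib_left[symmetric])
qed

lemma relabelled_mean_sym:
  assumes "\<And>q l q' l'. F q l q' l' = F l q l' q'"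
  shows "relabelled_mean A F q l = relabelled_mean A F l q"
  unfolding relabelled_mean_def by (subst sum.swap) (simp add: assms[of q l] mult.commute)

text \<open>
  The matrix has as its entry \<open>(q, q')\<close> the proportion of nodes assigned to \<open>q'\<close> among those whose label is \<open>q\<close>.
  A label that does not occur gets a vertex of the simplex as its row, to keep the matrix stochastic.
\<close>

lemma relabelling_matrix_exists:
  fixes a b :: "nat \<Rightarrow> 'q::finite"
  assumes "1 \<le> n"
  obtains A :: "real ^ 'q ^ 'q" where "stochastic_matrix A"
    and "\<And>h. (\<Sum>i\<in>{1..n}. h (a i) (b i) :: real) = (\<Sum>i\<in>{1..n}. \<Sum>q'\<in>UNIV. A $ a i $ q' * h (a i) q')"
proof -
  define N where "N q = {i \<in> {1..n}. a i = q}" for q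
  define M where "M q q' = {i \<in> N q. b i = q'}" for q q'
  define A :: "real ^ 'q ^ 'q" where "A = (\<chi> q q'. if N q = {} then of_bool (q' = q)
      else real (card (M q q')) / real (card (N q)))"
  have finite_N [simp]: "finite (N q)" for q
    by (simp add: N_def)
  have N_split: "(\<Sum>i\<in>N q. f (b i)) = (\<Sum>q'\<in>UNIV. real (card (M q q')) * f q')" for f :: "'q \<Rightarrow> real" and q
  proof -
    have "(\<Sum>i\<in>N q. f (b i)) = (\<Sum>q'\<in>UNIV. \<Sum>i\<in>M q q'. f (b i))"
      unfolding M_def by (rule sum.group[symmetric]) auto
    then show ?thesis by (simp add: M_def)
  qed
  have card_N: "real (card (N q)) * A $ q $ q' = real (card (M q q'))" for q q'
    by (cases "N q = {}") (auto simp: A_def M_def)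
  have "stochastic_matrix A"
    unfolding stochastic_matrix_def stochastic_vector_def
  proof (intro allI conjI)
    fix q q'
    show "0 \<le> A $ q $ q'" by (simp add: A_def)
    show "(\<Sum>q'\<in>UNIV. A $ q $ q') = 1"
    proof (cases "N q = {}")
      case False
      then have "card (N q) \<noteq> 0" by (simp add: card_eq_0_iff)
      have "(\<Sum>q'\<in>UNIV. A $ q $ q') = (\<Sum>q'\<in>UNIV. real (card (M q q'))) / real (card (N q))"
        using False by (simp add: A_def sum_divide_distrib)
      also have "(\<Sum>q'\<in>UNIV. real (card (M q q'))) = real (card (N q))"
        using N_split[of "\<lambda>_. 1" q] by simp
      finally show ?thesis
        using \<open>card (N q) \<noteq> 0\<close> by simp
    qed (simp add: A_def)
  qed
  moreover have "(\<Sum>i\<in>{1..n}. h (a i) (b i)) = (\<Sum>i\<in>{1..n}. \<Sum>q'\<in>UNIV. A $ a i $ q' * h (a i) q')"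
    for h :: "'q \<Rightarrow> 'q \<Rightarrow> real"
  proof -
    have "(\<Sum>i\<in>{1..n}. h (a i) (b i)) = (\<Sum>q\<in>UNIV. \<Sum>i\<in>N q. h (a i) (b i))"
      unfolding N_def by (rule sum.group[symmetric]) auto
    also have "\<dots> = (\<Sum>q\<in>UNIV. \<Sum>i\<in>N q. h q (b i))"
      by (intro sum.cong) (auto simp: N_def)
    also have "\<dots> = (\<Sum>q\<in>UNIV. real (card (N q)) * (\<Sum>q'\<in>UNIV. A $ q $ q' * h q q'))"
      unfolding N_split by (simp add: sum_distrib_left card_N mult.assoc[symmetric])
    also have "\<dots> = (\<Sum>q\<in>UNIV. \<Sum>i\<in>N q. \<Sum>q'\<in>UNIV. A $ a i $ q' * h (a i) q')"
      by (simp add: N_def)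
    also have "\<dots> = (\<Sum>i\<in>{1..n}. \<Sum>q'\<in>UNIV. A $ a i $ q' * h (a i) q')"
      unfolding N_def by (rule sum.group) auto
    finally show ?thesis .
  qed
  ultimately show thesis by (rule that)
qed

text \<open>
  On the full square of nodes, diagonal included, the two sums are equal: the empirical relabelling
  matrix is inserted first for \<open>i\<close> and then for \<open>j\<close>. The error is the two diagonals.
\<close>

lemma slice_le_some_relabelled_mean:
  fixes a b :: "nat \<Rightarrow> 'q::finite"
  assumes "1 \<le> n" and F: "\<And>q l q' l'. \<bar>F q l q' l'\<bar> \<le> C" "\<And>q l q' l'. F q l q' l' = F l q l' q'"
  obtains A where "stochastic_matrix A"
    and "(\<Sum>(i, j)\<in>upper_pairs n. F (a i) (a j) (b i) (b j))
      \<le> (\<Sum>(i, j)\<in>upper_pairs n. relabelled_mean A F (a i) (a j)) + real n * C"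
proof -
  from relabelling_matrix_exists[OF \<open>1 \<le> n\<close>, of a b] obtain A where A: "stochastic_matrix A"
    and sum_A: "\<And>h. (\<Sum>i\<in>{1..n}. h (a i) (b i) :: real)
      = (\<Sum>i\<in>{1..n}. \<Sum>q'\<in>UNIV. A $ a i $ q' * h (a i) q')"
    by blast
  have "(\<Sum>i\<in>{1..n}. \<Sum>j\<in>{1..n}. F (a i) (a j) (b i) (b j))
      = (\<Sum>i\<in>{1..n}. \<Sum>q'\<in>UNIV. A $ a i $ q' * (\<Sum>j\<in>{1..n}. F (a i) (a j) q' (b j)))"
    using sum_A[of "\<lambda>q q'. \<Sum>j\<in>{1..n}. F q (a j) q' (b j)"] by simp
  also have "\<dots> = (\<Sum>i\<in>{1..n}. \<Sum>q'\<in>UNIV. A $ a i $ q' *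
      (\<Sum>j\<in>{1..n}. \<Sum>l'\<in>UNIV. A $ a j $ l' * F (a i) (a j) q' l'))"
    using sum_A[of "\<lambda>l l'. F _ l _ l'"] by simp
  also have "\<dots> = (\<Sum>i\<in>{1..n}. \<Sum>j\<in>{1..n}. relabelled_mean A F (a i) (a j))"
    unfolding relabelled_mean_def sum_distrib_left
    by (intro sum.cong refl, subst sum.swap) (simp add: mult.assoc)
  finally have all: "(\<Sum>i\<in>{1..n}. \<Sum>j\<in>{1..n}. F (a i) (a j) (b i) (b j))
      = (\<Sum>i\<in>{1..n}. \<Sum>j\<in>{1..n}. relabelled_mean A F (a i) (a j))" .
  have "\<bar>\<Sum>i\<in>{1..n}. F (a i) (a i) (b i) (b i)\<bar> \<le> real n * C"
    "\<bar>\<Sum>i\<in>{1..n}. relabelled_mean A F (a i) (a i)\<bar> \<le> real n * C"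
    using abs_sum_le_of_bound[of "{1..n}" "\<lambda>i. F (a i) (a i) (b i) (b i)" C]
      abs_sum_le_of_bound[of "{1..n}" "\<lambda>i. relabelled_mean A F (a i) (a i)" C]
      F(1) relabelled_mean_bound[OF A F(1)] by simp_all
  moreover have "2 * (\<Sum>(i, j)\<in>upper_pairs n. F (a i) (a j) (b i) (b j)) + (\<Sum>i\<in>{1..n}. F (a i) (a i) (b i) (b i))
      = 2 * (\<Sum>(i, j)\<in>upper_pairs n. relabelled_mean A F (a i) (a j)) + (\<Sum>i\<in>{1..n}. relabelled_mean A F (a i) (a i))"
    using all sum_square_eq_upper_pairs[of "\<lambda>i j. F (a i) (a j) (b i) (b j)" n]
      sum_square_eq_upper_pairs[of "\<lambda>i j. relabelled_mean A F (a i) (a j)" n]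
      F(2) relabelled_mean_sym[of F A, OF F(2)] by simp
  ultimately have "(\<Sum>(i, j)\<in>upper_pairs n. F (a i) (a j) (b i) (b j))
      \<le> (\<Sum>(i, j)\<in>upper_pairs n. relabelled_mean A F (a i) (a j)) + real n * C"
    by argo
  with A show thesis by (rule that)
qed

text \<open>
  A probabilistic choice: if every node draws its new label independently from the row of \<open>A\<close> given by
  its old one, then the left-hand side is the expectation of the right-hand side, because the pairs
  in the sum consist of distinct nodes.
\<close>

lemma some_slice_ge_relabelled_mean:
  fixes a :: "nat \<Rightarrow> 'q::finite"
  assumes A: "stochastic_matrix A"
  obtains b where "(\<Sum>(i, j)\<in>upper_pairs n. relabelled_mean A F (a i) (a j))
      \<le> (\<Sum>(i, j)\<in>upper_pairs n. F (a i) (a j) (b i) (b j))"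
proof -
  let ?P = "Pi_pmf {1..n} undefined (\<lambda>i. vec_pmf (A $ a i))"
  let ?S = "\<lambda>b. \<Sum>(i, j)\<in>upper_pairs n. F (a i) (a j) (b i) (b j)"
  have int: "integrable ?P f" for f :: "(nat \<Rightarrow> 'q) \<Rightarrow> real"
    by (intro integrable_measure_pmf_finite finite_set_Pi_pmf) simp
  have "measure_pmf.expectation ?P ?S = (\<Sum>(i, j)\<in>upper_pairs n. relabelled_mean A F (a i) (a j))"
    unfolding case_prod_beta
  proof (subst Bochner_Integration.integral_sum[OF int], rule sum.cong[OF refl])
    fix p assume "p \<in> upper_pairs n"
    then show "measure_pmf.expectation ?P (\<lambda>b. F (a (fst p)) (a (snd p)) (b (fst p)) (b (snd p)))
        = relabelled_mean A F (a (fst p)) (a (snd p))"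
      unfolding relabelled_mean_def using A
      by (subst expectation_Pi_vec_pmf_two_components) (auto simp: upper_pairs_def stochastic_matrix_def)
  qed
  moreover have "\<exists>b. measure_pmf.expectation ?P ?S \<le> ?S b"
  proof (rule ccontr)
    assume "\<nexists>b. measure_pmf.expectation ?P ?S \<le> ?S b"
    then have "measure_pmf.expectation ?P ?S < measure_pmf.expectation ?P ?S"
      by (intro measure_pmf.expectation_less[OF int]) (auto simp: not_le)
    then show False by simp
  qed
  ultimately show thesis using that by auto
qed

section \<open>Replacing the complete-data likelihood by its conditional mean\<close>

text \<open>
  The conditional mean of the log-likelihood of one edge whose end points have true labels \<open>q\<close>, \<open>l\<close> and
  assigned labels \<open>q'\<close>, \<open>l'\<close>.
\<close>

definition cross_loglik :: "real ^ 'q ^ 'q \<Rightarrow> real ^ 'q ^ 'q::finite \<Rightarrow> 'q \<Rightarrow> 'q \<Rightarrow> 'q \<Rightarrow> 'q \<Rightarrow> real" where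
  "cross_loglik \<pi>s \<pi> q l q' l' =
     \<pi>s $ q $ l * ln (\<pi> $ q' $ l') + (1 - \<pi>s $ q $ l) * ln (1 - \<pi> $ q' $ l')"

text \<open>
  The conditional mean of \<open>complete_loglik n T \<pi> e z\<close> given that the true labels are \<open>a\<close>.
\<close>

definition expected_loglik ::
  "nat \<Rightarrow> nat \<Rightarrow> real ^ 'q ^ 'q \<Rightarrow> real ^ 'q ^ 'q::finite \<Rightarrow> (nat \<Rightarrow> nat \<Rightarrow> 'q) \<Rightarrow> (nat \<Rightarrow> nat \<Rightarrow> 'q) \<Rightarrow> real" where
  "expected_loglik n T \<pi>s \<pi> a z =
     (\<Sum>(t, i, j)\<in>edge_indices n T. cross_loglik \<pi>s \<pi> (a i t) (a j t) (z i t) (z j t))"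

text \<open>
  The centred number of edges between the classes \<open>c\<close> of the assignment \<open>z\<close>. The pair \<open>c\<close> is ordered as
  the nodes are, by \<open>i < j\<close>.
\<close>

definition edge_excess ::
  "nat \<Rightarrow> nat \<Rightarrow> real ^ 'q ^ 'q::finite \<Rightarrow> (nat \<Rightarrow> nat \<Rightarrow> 'q) \<Rightarrow> (nat \<times> nat \<times> nat \<Rightarrow> bool)
    \<Rightarrow> (nat \<Rightarrow> nat \<Rightarrow> 'q) \<Rightarrow> 'q \<times> 'q \<Rightarrow> real" where
  "edge_excess n T \<pi>s a e z c =
     (\<Sum>(t, i, j)\<in>{(t, i, j) \<in> edge_indices n T. (z i t, z j t) = c}. of_bool (e (t, i, j)) - \<pi>s $ a i t $ a j t)"

definition label_discrepancy :: "nat \<Rightarrow> nat \<Rightarrow> real ^ 'q::finite \<Rightarrow> (nat \<Rightarrow> nat \<Rightarrow> 'q) \<Rightarrow> real" where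
  "label_discrepancy n T v a = (\<Sum>t\<in>{1..T}. \<Sum>q\<in>UNIV. \<bar>label_freq n (\<lambda>i. a i t) q - v $ q\<bar>)"

lemma limit_objective_at_eq_pair_mean:
  "limit_objective_at \<Gamma>s \<pi>s \<pi> A
    = pair_mean (\<lambda>q. stationary_distribution \<Gamma>s $ q) (relabelled_mean A (cross_loglik \<pi>s \<pi>))"
  by (simp add: limit_objective_at_def pair_mean_def relabelled_mean_def cross_loglik_def Let_def)

lemma cross_loglik_bound:
  assumes "\<And>q l. 0 \<le> \<pi>s $ q $ l" "\<And>q l. \<pi>s $ q $ l \<le> 1"
    and "0 < \<zeta>" "\<And>q l. \<pi> $ q $ l \<in> {\<zeta>..1 - \<zeta>}"
  shows "\<bar>cross_loglik \<pi>s \<pi> q l q' l'\<bar> \<le> - ln \<zeta>"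
proof -
  let ?x = "ln (\<pi> $ q' $ l')" and ?y = "ln (1 - \<pi> $ q' $ l')"
  have xy: "ln \<zeta> \<le> ?x" "ln \<zeta> \<le> ?y" "?x \<le> 0" "?y \<le> 0"
    using assms(3) assms(4)[of q' l'] by (auto simp: ln_le_zero_iff)
  have "\<pi>s $ q $ l * ln \<zeta> + (1 - \<pi>s $ q $ l) * ln \<zeta> \<le> cross_loglik \<pi>s \<pi> q l q' l'"
    unfolding cross_loglik_def using assms(1,2) xy by (intro add_mono mult_left_mono) auto
  moreover have "cross_loglik \<pi>s \<pi> q l q' l' \<le> 0"
    unfolding cross_loglik_def using assms(1,2) xy by (intro add_nonpos_nonpos mult_nonneg_nonpos) auto
  ultimately show ?thesis by (simp add: algebra_simps)
qed

text \<open>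
  The difference is the sum over the class pairs \<open>c\<close> of \<open>edge_excess\<close> times the log-odds of \<open>\<pi>\<close> at \<open>c\<close>. The
  random part is free of \<open>\<pi>\<close>, and the log-odds lie in \<open>{ln \<zeta>..- ln \<zeta>}\<close>.
\<close>

lemma complete_loglik_near_expected:
  fixes \<pi>s \<pi> :: "real ^ 'q ^ 'q::finite"
  assumes "0 < \<zeta>" "\<And>q l. \<pi> $ q $ l \<in> {\<zeta>..1 - \<zeta>}" and D: "\<And>c. \<bar>edge_excess n T \<pi>s a e z c\<bar> \<le> s"
  shows "\<bar>complete_loglik n T \<pi> e z - expected_loglik n T \<pi>s \<pi> a z\<bar> \<le> (real CARD('q))\<^sup>2 * (- ln \<zeta> * s)"
proof -
  let ?E = "edge_indices n T"
  let ?w = "\<lambda>(q, l). ln (\<pi> $ q $ l) - ln (1 - \<pi> $ q $ l)"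
  let ?lab = "\<lambda>(t, i, j). (z i t, z j t)"
  let ?x = "\<lambda>(t, i, j). of_bool (e (t, i, j)) - \<pi>s $ a i t $ a j t"
  have "complete_loglik n T \<pi> e z - expected_loglik n T \<pi>s \<pi> a z = (\<Sum>k\<in>?E. ?x k * ?w (?lab k))"
    unfolding complete_loglik_def expected_loglik_def sum_subtractf[symmetric]
    by (intro sum.cong) (auto simp: cross_loglik_def algebra_simps)
  also have "\<dots> = (\<Sum>c\<in>UNIV. \<Sum>k\<in>{k \<in> ?E. ?lab k = c}. ?x k * ?w (?lab k))"
    by (rule sum.group[symmetric]) auto
  also have "\<dots> = (\<Sum>c\<in>UNIV. ?w c * edge_excess n T \<pi>s a e z c)"
    unfolding edge_excess_def sum_distrib_left by (intro sum.cong) (auto simp: mult.commute)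
  also have "\<bar>\<dots>\<bar> \<le> real (card (UNIV :: ('q \<times> 'q) set)) * (- ln \<zeta> * s)"
  proof (rule abs_sum_le_of_bound)
    fix c :: "'q \<times> 'q"
    obtain q l where c: "c = (q, l)" by (cases c)
    have "\<bar>?w c\<bar> \<le> - ln \<zeta>"
    proof -
      have "ln \<zeta> \<le> ln (\<pi> $ q $ l)" "ln \<zeta> \<le> ln (1 - \<pi> $ q $ l)" "ln (\<pi> $ q $ l) \<le> 0" "ln (1 - \<pi> $ q $ l) \<le> 0"
        using assms(1) assms(2)[of q l] by (auto simp: ln_le_zero_iff)
      then show ?thesis by (simp add: c)
    qed
    then show "\<bar>?w c * edge_excess n T \<pi>s a e z c\<bar> \<le> - ln \<zeta> * s"
      unfolding abs_mult using D[of c] by (intro mult_mono) auto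
  qed
  finally show ?thesis by (simp add: card_cartesian_product power2_eq_square flip: UNIV_Times_UNIV)
qed

text \<open>
  A union bound over the labels and the class pairs. Although \<open>z\<close> ranges over all functions, only its
  values on \<open>{1..n}\<close> and \<open>{1..T}\<close> matter, which leaves \<open>(Q ^ T) ^ n\<close> configurations.
\<close>

lemma edge_excess_tail:
  fixes \<pi>s :: "real ^ 'q ^ 'q::finite"
  assumes \<pi>s: "\<And>q l. \<pi>s $ q $ l \<in> {0..1}" and "2 \<le> n" "1 \<le> T" "0 \<le> s"
  shows "measure_pmf.prob (Pi_pmf (edge_indices n T) False (\<lambda>(t, i, j). bernoulli_pmf (\<pi>s $ a i t $ a j t)))
      {e. \<exists>z c. s \<le> \<bar>edge_excess n T \<pi>s a e z c\<bar>}
    \<le> (real CARD('q) ^ T) ^ n * (real CARD('q))\<^sup>2 * (2 * exp (- 2 * s\<^sup>2 / real (card (edge_indices n T))))"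
proof -
  let ?E = "edge_indices n T"
  let ?p = "\<lambda>(t, i, j). \<pi>s $ a i t $ a j t"
  let ?P = "Pi_pmf ?E False (\<lambda>(t, i, j). bernoulli_pmf (\<pi>s $ a i t $ a j t))"
  let ?B = "\<lambda>(z, c). {e. s \<le> \<bar>edge_excess n T \<pi>s a e z c\<bar>}"
  let ?bd = "2 * exp (- 2 * s\<^sup>2 / real (card ?E))"
  define Z :: "(nat \<Rightarrow> nat \<Rightarrow> 'q) set"
    where "Z = PiE_dflt {1..n} (\<lambda>_. undefined) (\<lambda>_. PiE_dflt {1..T} undefined (\<lambda>_. UNIV))"
  have finite_Z: "finite Z"
    unfolding Z_def by (intro finite_PiE_dflt) auto
  have card_Z: "card Z = (CARD('q) ^ T) ^ n"
    unfolding Z_def by (simp add: card_PiE_dflt finite_PiE_dflt)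
  have E: "?E \<noteq> {}"
  proof -
    have "(1, 1, 2) \<in> ?E" using assms by (simp add: edge_indices_def)
    then show ?thesis by blast
  qed
  have P: "?P = Pi_pmf ?E False (\<lambda>k. bernoulli_pmf (?p k))"
    by (rule Pi_pmf_cong) auto
  have "{e. \<exists>z c. s \<le> \<bar>edge_excess n T \<pi>s a e z c\<bar>} \<subseteq> (\<Union>zc\<in>Z \<times> UNIV. ?B zc)"
  proof safe
    fix e z and x y :: 'q assume s: "s \<le> \<bar>edge_excess n T \<pi>s a e z (x, y)\<bar>"
    define z' where "z' = (\<lambda>i. if i \<in> {1..n} then \<lambda>t. if t \<in> {1..T} then z i t else undefined
      else (\<lambda>_. undefined))"
    have "edge_excess n T \<pi>s a e z' (x, y) = edge_excess n T \<pi>s a e z (x, y)"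
      unfolding edge_excess_def by (intro sum.cong) (auto simp: edge_indices_def z'_def)
    moreover have "z' \<in> Z"
      by (auto simp: Z_def PiE_dflt_def z'_def)
    ultimately show "e \<in> (\<Union>zc\<in>Z \<times> UNIV. ?B zc)"
      using s by (intro UN_I[of "(z', (x, y))"]) auto
  qed
  then have "measure_pmf.prob ?P {e. \<exists>z c. s \<le> \<bar>edge_excess n T \<pi>s a e z c\<bar>}
      \<le> measure_pmf.prob ?P (\<Union>zc\<in>Z \<times> UNIV. ?B zc)"
    by (intro measure_pmf.finite_measure_mono) auto
  also have "\<dots> \<le> (\<Sum>zc\<in>Z \<times> (UNIV :: ('q \<times> 'q) set). measure_pmf.prob ?P (?B zc))"
    using finite_Z by (intro measure_pmf.finite_measure_subadditive_finite) auto
  also have "\<dots> \<le> real (card (Z \<times> (UNIV :: ('q \<times> 'q) set))) * ?bd"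
  proof (rule sum_bounded_above, clarify)
    fix z and x y :: 'q
    let ?S = "{(t, i, j) \<in> ?E. (z i t, z j t) = (x, y)}"
    have "measure_pmf.prob (Pi_pmf ?E False (\<lambda>k. bernoulli_pmf (?p k)))
        {e. s \<le> \<bar>\<Sum>k\<in>?S. of_bool (e k) - ?p k\<bar>} \<le> ?bd"
      using \<pi>s E \<open>0 \<le> s\<close> by (intro Pi_bernoulli_concentration) auto
    then show "measure_pmf.prob ?P {e. s \<le> \<bar>edge_excess n T \<pi>s a e z (x, y)\<bar>} \<le> ?bd"
      unfolding P edge_excess_def by (simp add: case_prod_beta)
  qed
  finally show ?thesis
    by (simp add: card_cartesian_product card_Z power2_eq_square flip: UNIV_Times_UNIV)
qed

section \<open>Fluctuation of the label frequencies\<close>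

text \<open>
  The variance of \<open>n\<close> times the frequency is at most \<open>n\<close>, since distinct nodes are uncorrelated. The
  step from the second to the first absolute moment is \<open>2 sqrt n \<bar>u\<bar> \<le> u\<^sup>2 + n\<close>.
\<close>

lemma expectation_label_freq_deviation:
  fixes v :: "real ^ 'q::finite"
  assumes v: "stochastic_vector v" and "1 \<le> n"
  shows "measure_pmf.expectation (Pi_pmf {1..n} d (\<lambda>_. vec_pmf v)) (\<lambda>a. \<bar>label_freq n a q - v $ q\<bar>)
    \<le> 1 / sqrt (real n)"
proof -
  let ?P = "Pi_pmf {1..n} d (\<lambda>_. vec_pmf v)"
  let ?y = "\<lambda>x. of_bool (x = q) - v $ q"
  have int: "integrable ?P f" for f :: "(nat \<Rightarrow> 'q) \<Rightarrow> real"
    by (intro integrable_measure_pmf_finite finite_set_Pi_pmf) simp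
  have v1: "0 \<le> v $ x" "(\<Sum>x\<in>UNIV. v $ x) = 1" for x
    using v by (auto simp: stochastic_vector_def)
  have "v $ q \<le> (\<Sum>x\<in>UNIV. v $ x)"
    by (rule member_le_sum) (auto simp: v1)
  then have v_le: "v $ q \<le> 1" by (simp add: v1)
  have mean: "(\<Sum>x\<in>UNIV. v $ x * ?y x) = 0"
    using v1 by (simp add: right_diff_distrib sum_subtractf flip: sum_distrib_right)
  have pair: "measure_pmf.expectation ?P (\<lambda>a. ?y (a i) * ?y (a j)) \<le> of_bool (i = j)"
    if "i \<in> {1..n}" "j \<in> {1..n}" for i j
  proof (cases "i = j")
    case True
    have "\<bar>?y x\<bar> \<le> 1" for x using v1(1)[of q] v_le by auto
    then have "?y x * ?y x \<le> 1" for x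
      by (metis abs_mult_self_eq abs_ge_zero mult_le_one)
    then have "measure_pmf.expectation ?P (\<lambda>a. ?y (a j) * ?y (a j)) \<le> 1"
      by (intro measure_pmf.integral_le_const[OF int]) simp
    then show ?thesis using True by simp
  next
    case False
    then have "measure_pmf.expectation ?P (\<lambda>a. ?y (a i) * ?y (a j))
        = (\<Sum>x\<in>UNIV. \<Sum>x'\<in>UNIV. v $ x * v $ x' * (?y x * ?y x'))"
      using that v by (intro expectation_Pi_vec_pmf_two_components) auto
    also have "\<dots> = (\<Sum>x\<in>UNIV. v $ x * ?y x) * (\<Sum>x'\<in>UNIV. v $ x' * ?y x')"
      unfolding sum_product by (intro sum.cong refl) (simp only: mult_ac)
    finally show ?thesis using False mean by simp
  qed
  have sq: "real n * (label_freq n a q - v $ q) = (\<Sum>i\<in>{1..n}. ?y (a i))" for a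
  proof -
    have "(\<Sum>i\<in>{1..n}. of_bool (a i = q) :: real) = real (card {i \<in> {1..n}. a i = q})"
      by (simp add: Int_def)
    then show ?thesis
      using \<open>1 \<le> n\<close> by (simp add: sum_subtractf label_freq_def algebra_simps)
  qed
  have "measure_pmf.expectation ?P (\<lambda>a. (real n * (label_freq n a q - v $ q))\<^sup>2)
      = (\<Sum>i\<in>{1..n}. \<Sum>j\<in>{1..n}. measure_pmf.expectation ?P (\<lambda>a. ?y (a i) * ?y (a j)))"
    unfolding sq power2_eq_square sum_product
    by (subst Bochner_Integration.integral_sum[OF int], intro sum.cong refl)
      (rule Bochner_Integration.integral_sum[OF int])
  also have "\<dots> \<le> (\<Sum>i\<in>{1..n}. \<Sum>j\<in>{1..n}. of_bool (i = j))"
    by (intro sum_mono pair)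
  also have "\<dots> = real n" by simp
  finally have var: "measure_pmf.expectation ?P (\<lambda>a. (real n * (label_freq n a q - v $ q))\<^sup>2) \<le> real n" .
  have amgm: "\<bar>label_freq n a q - v $ q\<bar>
      \<le> ((real n * (label_freq n a q - v $ q))\<^sup>2 + real n) * (1 / (2 * real n * sqrt (real n)))" for a
  proof -
    define d where "d = label_freq n a q - v $ q"
    have "0 \<le> (real n * \<bar>d\<bar> - sqrt (real n))\<^sup>2" by simp
    then have "\<bar>d\<bar> * (2 * real n * sqrt (real n)) \<le> (real n * d)\<^sup>2 + real n"
      by (simp add: power2_diff power_mult_distrib mult_ac)
    then have "\<bar>d\<bar> \<le> ((real n * d)\<^sup>2 + real n) / (2 * real n * sqrt (real n))"
      using \<open>1 \<le> n\<close> by (subst pos_le_divide_eq) simp_all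
    then show ?thesis by (simp add: d_def)
  qed
  have "measure_pmf.expectation ?P (\<lambda>a. \<bar>label_freq n a q - v $ q\<bar>)
      \<le> measure_pmf.expectation ?P (\<lambda>a. ((real n * (label_freq n a q - v $ q))\<^sup>2 + real n) * (1 / (2 * real n * sqrt (real n))))"
    by (intro integral_mono int amgm)
  also have "\<dots> = (measure_pmf.expectation ?P (\<lambda>a. (real n * (label_freq n a q - v $ q))\<^sup>2) + real n)
      * (1 / (2 * real n * sqrt (real n)))"
    by (simp only: integral_mult_left_zero Bochner_Integration.integral_add[OF int int]) simp
  also have "\<dots> \<le> (real n + real n) * (1 / (2 * real n * sqrt (real n)))"
    by (intro mult_right_mono add_right_mono var) simp
  also have "\<dots> = 1 / sqrt (real n)"
    using \<open>1 \<le> n\<close> by (simp add: field_simps)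
  finally show ?thesis .
qed

text \<open>
  Times are dependent, but only the expectation of the sum over time is used, for which the marginal
  at each time suffices.
\<close>

lemma label_discrepancy_tail:
  fixes \<Gamma> :: "real ^ 'q ^ 'q::finite"
  assumes G: "stochastic_matrix \<Gamma>" "\<And>q l. \<delta> \<le> \<Gamma> $ q $ l" and "0 < \<delta>"
    and "1 \<le> n" "1 \<le> T" "0 < \<eta>"
  shows "measure_pmf.prob (labels_pmf n T \<Gamma>) {a. \<eta> * real T \<le> label_discrepancy n T (stationary_distribution \<Gamma>) a}
    \<le> real CARD('q) / (\<eta> * sqrt (real n))"
proof -
  let ?v = "stationary_distribution \<Gamma>"
  note v = stationary_distribution_is_stationary[OF G \<open>0 < \<delta>\<close>]
  have marginal: "map_pmf (\<lambda>a i. a i t) (labels_pmf n T \<Gamma>) = Pi_pmf {1..n} undefined (\<lambda>_. vec_pmf ?v)"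
    if "t \<in> {1..T}" for t
    unfolding labels_pmf_def markov_chain_marginal[OF G(1) v that, symmetric]
    by (subst Pi_pmf_map[where dflt = "\<lambda>_. undefined"]) (auto intro!: map_pmf_cong)
  have freq_dev: "measure_pmf.expectation (labels_pmf n T \<Gamma>) (\<lambda>a. \<bar>label_freq n (\<lambda>i. a i t) q - ?v $ q\<bar>)
      \<le> 1 / sqrt (real n)" if "t \<in> {1..T}" for t q
    using expectation_label_freq_deviation[OF v(1) \<open>1 \<le> n\<close>, of undefined q]
    unfolding marginal[OF that, symmetric] by simp
  have int: "integrable (labels_pmf n T \<Gamma>) (\<lambda>a. \<bar>label_freq n (\<lambda>i. a i t) q - ?v $ q\<bar>)" for t q
  proof (rule measure_pmf.integrable_const_bound[where B = "1 + \<bar>?v $ q\<bar>"])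
    have "\<bar>label_freq n (\<lambda>i. a i t) q\<bar> \<le> 1" for a :: "nat \<Rightarrow> nat \<Rightarrow> 'q"
      using member_le_sum[of q UNIV "label_freq n (\<lambda>i. a i t)"] sum_label_freq[OF \<open>1 \<le> n\<close>, of "\<lambda>i. a i t"]
        label_freq_nonneg[of n "\<lambda>i. a i t"] by simp
    then show "AE a in labels_pmf n T \<Gamma>. norm \<bar>label_freq n (\<lambda>i. a i t) q - ?v $ q\<bar> \<le> 1 + \<bar>?v $ q\<bar>"
      by (intro AE_I2) (smt (verit) real_norm_def)
  qed simp
  have int_discrepancy: "integrable (labels_pmf n T \<Gamma>) (label_discrepancy n T ?v)"
    unfolding label_discrepancy_def by (intro Bochner_Integration.integrable_sum int)
  have discrepancy_nonneg: "0 \<le> label_discrepancy n T ?v a" for a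
    by (simp add: label_discrepancy_def sum_nonneg)
  have "measure_pmf.expectation (labels_pmf n T \<Gamma>) (label_discrepancy n T ?v)
      = (\<Sum>t\<in>{1..T}. \<Sum>q\<in>UNIV. measure_pmf.expectation (labels_pmf n T \<Gamma>)
          (\<lambda>a. \<bar>label_freq n (\<lambda>i. a i t) q - ?v $ q\<bar>))"
    unfolding label_discrepancy_def by (simp add: Bochner_Integration.integral_sum int)
  also have "\<dots> \<le> (\<Sum>t\<in>{1..T}. \<Sum>q\<in>(UNIV :: 'q set). 1 / sqrt (real n))"
    by (intro sum_mono freq_dev)
  also have "\<dots> = real T * real CARD('q) / sqrt (real n)" by simp
  finally have mean: "measure_pmf.expectation (labels_pmf n T \<Gamma>) (label_discrepancy n T ?v)
      \<le> real T * real CARD('q) / sqrt (real n)" .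
  have "measure_pmf.prob (labels_pmf n T \<Gamma>) {a. \<eta> * real T \<le> label_discrepancy n T ?v a}
      \<le> measure_pmf.expectation (labels_pmf n T \<Gamma>) (label_discrepancy n T ?v) / (\<eta> * real T)"
    using integral_Markov_inequality_measure[of "labels_pmf n T \<Gamma>" "label_discrepancy n T ?v" UNIV "\<eta> * real T"]
      assms int_discrepancy discrepancy_nonneg by simp
  also have "\<dots> \<le> (real T * real CARD('q) / sqrt (real n)) / (\<eta> * real T)"
    using assms by (intro divide_right_mono mean) simp
  also have "\<dots> = real CARD('q) / (\<eta> * sqrt (real n))"
    using assms by simp
  finally show ?thesis .
qed

section \<open>Comparison with the limit objective\<close>

lemma card_edge_indices: "real (card (edge_indices n T)) = real T * (real n * (real n - 1) / 2)"
  by (simp add: edge_indices_eq card_cartesian_product card_upper_pairs)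

lemma limit_objective_bounds:
  fixes \<Gamma>s \<pi>s \<pi> :: "real ^ 'q ^ 'q::finite"
  assumes v: "stochastic_vector (stationary_distribution \<Gamma>s)"
    and F: "\<And>q l q' l'. \<bar>cross_loglik \<pi>s \<pi> q l q' l'\<bar> \<le> C"
  shows "stochastic_matrix A \<Longrightarrow> limit_objective_at \<Gamma>s \<pi>s \<pi> A \<le> limit_objective \<Gamma>s \<pi>s \<pi>"
    and "(\<And>A. stochastic_matrix A \<Longrightarrow> limit_objective_at \<Gamma>s \<pi>s \<pi> A \<le> B) \<Longrightarrow> limit_objective \<Gamma>s \<pi>s \<pi> \<le> B"
proof -
  have "limit_objective_at \<Gamma>s \<pi>s \<pi> A \<le> C" if "stochastic_matrix A" for A
    using pair_mean_bound[of "\<lambda>q. stationary_distribution \<Gamma>s $ q" "relabelled_mean A (cross_loglik \<pi>s \<pi>)" C]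
      v relabelled_mean_bound[OF that F]
    by (simp add: limit_objective_at_eq_pair_mean stochastic_vector_def)
  then have "bdd_above (limit_objective_at \<Gamma>s \<pi>s \<pi> ` {A. stochastic_matrix A})"
    by (intro bdd_aboveI2[where M = C]) simp
  then show "stochastic_matrix A \<Longrightarrow> limit_objective_at \<Gamma>s \<pi>s \<pi> A \<le> limit_objective \<Gamma>s \<pi>s \<pi>"
    unfolding limit_objective_def by (intro cSUP_upper) simp_all
  have "stochastic_matrix (\<chi> q. axis q 1 :: real ^ 'q ^ 'q)"
    by (simp add: stochastic_matrix_def stochastic_vector_vertex)
  then show "(\<And>A. stochastic_matrix A \<Longrightarrow> limit_objective_at \<Gamma>s \<pi>s \<pi> A \<le> B) \<Longrightarrow> limit_objective \<Gamma>s \<pi>s \<pi> \<le> B"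
    unfolding limit_objective_def by (intro cSUP_least) auto
qed

text \<open>
  Slice by slice. For an upper bound the relabelling matrix may change with \<open>t\<close>, but each of them is
  dominated by the supremum; for the lower bound the same \<open>A\<close> is used at all times.
\<close>

lemma expected_loglik_near_limit:
  fixes \<Gamma>s \<pi>s \<pi> :: "real ^ 'q ^ 'q::finite" and n T :: nat and a :: "nat \<Rightarrow> nat \<Rightarrow> 'q"
  assumes "1 \<le> n" and v: "stochastic_vector (stationary_distribution \<Gamma>s)"
    and F: "\<And>q l q' l'. \<bar>cross_loglik \<pi>s \<pi> q l q' l'\<bar> \<le> C"
      "\<And>q l q' l'. cross_loglik \<pi>s \<pi> q l q' l' = cross_loglik \<pi>s \<pi> l q l' q'"
  defines "N \<equiv> real (card (edge_indices n T))"
    and "R \<equiv> (real n)\<^sup>2 * C * label_discrepancy n T (stationary_distribution \<Gamma>s) a + 2 * real n * real T * C"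
  shows "expected_loglik n T \<pi>s \<pi> a z \<le> N * limit_objective \<Gamma>s \<pi>s \<pi> + R"
    and "stochastic_matrix A \<Longrightarrow> \<exists>z. N * limit_objective_at \<Gamma>s \<pi>s \<pi> A \<le> expected_loglik n T \<pi>s \<pi> a z + R"
proof -
  let ?F = "cross_loglik \<pi>s \<pi>" and ?U = "real (card (upper_pairs n))"
  let ?w = "\<lambda>t. \<Sum>q\<in>UNIV. \<bar>label_freq n (\<lambda>i. a i t) q - stationary_distribution \<Gamma>s $ q\<bar>"
  let ?slice = "\<lambda>z t. \<Sum>(i, j)\<in>upper_pairs n. ?F (a i t) (a j t) (z i t) (z j t)"
  let ?mean = "\<lambda>A t. \<Sum>(i, j)\<in>upper_pairs n. relabelled_mean A ?F (a i t) (a j t)"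
  have C: "0 \<le> C" using F(1) by (rule order.trans[OF abs_ge_zero])
  have mean: "\<bar>?mean A t - ?U * limit_objective_at \<Gamma>s \<pi>s \<pi> A\<bar> \<le> (real n)\<^sup>2 * C * ?w t + real n * C"
    if "stochastic_matrix A" for A t
    unfolding limit_objective_at_eq_pair_mean
    by (rule slice_sum_near_pair_mean[OF \<open>1 \<le> n\<close>])
      (use v relabelled_mean_bound[OF that F(1)] relabelled_mean_sym[of ?F A, OF F(2)]
        in \<open>auto simp: stochastic_vector_def\<close>)
  have split: "expected_loglik n T \<pi>s \<pi> a z = (\<Sum>t\<in>{1..T}. ?slice z t)" for z
    unfolding expected_loglik_def by (rule sum_edge_indices)
  have N: "N * x = (\<Sum>t\<in>{1..T}. ?U * x)" for x
    by (simp add: N_def edge_indices_eq card_cartesian_product)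
  have R: "R = (\<Sum>t\<in>{1..T}. (real n)\<^sup>2 * C * ?w t + 2 * (real n * C))"
    by (simp add: R_def label_discrepancy_def sum.distrib sum_distrib_left)
  show "expected_loglik n T \<pi>s \<pi> a z \<le> N * limit_objective \<Gamma>s \<pi>s \<pi> + R"
    unfolding split N R sum.distrib[symmetric]
  proof (rule sum_mono)
    fix t
    obtain A where A: "stochastic_matrix A" "?slice z t \<le> ?mean A t + real n * C"
      using slice_le_some_relabelled_mean[where F = ?F and C = C and a = "\<lambda>i. a i t" and b = "\<lambda>i. z i t",
          OF \<open>1 \<le> n\<close> F] .
    have "?U * limit_objective_at \<Gamma>s \<pi>s \<pi> A \<le> ?U * limit_objective \<Gamma>s \<pi>s \<pi>"
      using limit_objective_bounds(1)[OF v F(1) A(1)] by (rule mult_left_mono) simp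
    then show "?slice z t \<le> ?U * limit_objective \<Gamma>s \<pi>s \<pi> + ((real n)\<^sup>2 * C * ?w t + 2 * (real n * C))"
      using A(2) mean[OF A(1), of t] by linarith
  qed
  show "\<exists>z. N * limit_objective_at \<Gamma>s \<pi>s \<pi> A \<le> expected_loglik n T \<pi>s \<pi> a z + R"
    if A: "stochastic_matrix A"
  proof -
    have "\<exists>b. ?mean A t \<le> (\<Sum>(i, j)\<in>upper_pairs n. ?F (a i t) (a j t) (b i) (b j))" for t
      using some_slice_ge_relabelled_mean[OF A, where n = n and F = ?F and a = "\<lambda>i. a i t"] by blast
    then have "\<exists>b. \<forall>t. ?mean A t \<le> ?slice (\<lambda>i t. b t i) t"
      by (intro choice allI)
    then obtain b where b: "\<And>t. ?mean A t \<le> ?slice (\<lambda>i t. b t i) t" by blast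
    have "N * limit_objective_at \<Gamma>s \<pi>s \<pi> A \<le> expected_loglik n T \<pi>s \<pi> a (\<lambda>i t. b t i) + R"
      unfolding split N R sum.distrib[symmetric]
    proof (rule sum_mono)
      fix t
      have "0 \<le> real n * C" using C by simp
      then show "?U * limit_objective_at \<Gamma>s \<pi>s \<pi> A
          \<le> ?slice (\<lambda>i t. b t i) t + ((real n)\<^sup>2 * C * ?w t + 2 * (real n * C))"
        using b[of t] mean[OF A, of t] by linarith
    qed
    then show ?thesis by blast
  qed
qed

text \<open>
  The deterministic core: on the event that the edge counts and the label frequencies are close to
  their means, the deviation is small for all parameters at once. The last term of the bound collects the diagonal
  terms and the prior weight of a configuration, of order \<open>n T\<close> out of \<open>N\<close>.
\<close>

lemma uniform_deviation_le:
  fixes \<Gamma>s \<pi>s :: "real ^ 'q ^ 'q::finite"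
  assumes \<theta>s: "(\<Gamma>s, \<pi>s) \<in> param_space \<delta> \<zeta>" and "0 < \<delta>" "0 < \<zeta>" and "2 \<le> n" "1 \<le> T"
    and e: "\<forall>k. k \<notin> edge_indices n T \<longrightarrow> \<not> e k"
    and D: "\<And>z c. \<bar>edge_excess n T \<pi>s a e z c\<bar> \<le> \<sigma> * real (card (edge_indices n T))"
    and "0 \<le> \<eta>"
    and W: "label_discrepancy n T (stationary_distribution \<Gamma>s) a \<le> \<eta> * real T"
  shows "uniform_deviation \<delta> \<zeta> n T \<Gamma>s \<pi>s (adjacency e)
    \<le> - 4 * ln \<zeta> * \<eta> + (real CARD('q))\<^sup>2 * (- ln \<zeta>) * \<sigma> + (- 8 * ln \<zeta> - 4 * ln \<delta>) / real n"
  unfolding uniform_deviation_def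
proof (rule cSUP_least, use \<theta>s in blast, clarify)
  fix \<Gamma> \<pi> :: "real ^ 'q ^ 'q"
  assume \<theta>: "(\<Gamma>, \<pi>) \<in> param_space \<delta> \<zeta>"
  define C where "C = - ln \<zeta>"
  define N where "N = real (card (edge_indices n T))"
  define L where "L = ln (pmf (map_pmf snd (dsbm_pmf n T \<Gamma> \<pi>)) (adjacency e))"
  define R where "R = (real n)\<^sup>2 * C * label_discrepancy n T (stationary_distribution \<Gamma>s) a
    + 2 * real n * real T * C"
  define S where "S = (real CARD('q))\<^sup>2 * (- ln \<zeta> * (\<sigma> * N))"
  let ?M = "limit_objective \<Gamma>s \<pi>s \<pi>"
  have N: "N = real T * (real n * (real n - 1) / 2)"
    by (simp add: N_def card_edge_indices)
  have N_pos: "0 < N" using \<open>2 \<le> n\<close> \<open>1 \<le> T\<close> by (simp add: N)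
  have Gs: "stochastic_matrix \<Gamma>s" "\<And>q l. \<delta> \<le> \<Gamma>s $ q $ l"
    and G: "stochastic_matrix \<Gamma>" "\<And>q l. \<delta> \<le> \<Gamma> $ q $ l"
    and \<pi>: "\<And>q l. \<pi> $ q $ l \<in> {\<zeta>..1 - \<zeta>}" and \<pi>s: "\<And>q l. \<pi>s $ q $ l \<in> {\<zeta>..1 - \<zeta>}"
    using \<theta> \<theta>s unfolding param_space_def by auto
  have \<pi>01: "0 < \<pi> $ q $ l" "\<pi> $ q $ l < 1" and \<pi>s01: "0 \<le> \<pi>s $ q $ l" "\<pi>s $ q $ l \<le> 1" for q l
    using \<pi>[of q l] \<pi>s[of q l] \<open>0 < \<zeta>\<close> by auto
  have sym: "\<pi> $ q $ l = \<pi> $ l $ q" "\<pi>s $ q $ l = \<pi>s $ l $ q" for q l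
    using \<theta> \<theta>s unfolding param_space_def transpose_def by (auto simp: vec_eq_iff)
  have F: "\<bar>cross_loglik \<pi>s \<pi> q l q' l'\<bar> \<le> C" "cross_loglik \<pi>s \<pi> q l q' l' = cross_loglik \<pi>s \<pi> l q l' q'" for q l q' l'
    unfolding C_def using cross_loglik_bound[OF \<pi>s01 \<open>0 < \<zeta>\<close> \<pi>] sym
    by (auto simp: cross_loglik_def)
  have C: "0 \<le> C" using F(1) by (rule order.trans[OF abs_ge_zero])
  note v = stationary_distribution_is_stationary(1)[OF Gs \<open>0 < \<delta>\<close>]
  note limit = expected_loglik_near_limit[OF _ v F, where n = n and T = T and a = a, folded N_def R_def]
  have near: "\<bar>complete_loglik n T \<pi> e z - expected_loglik n T \<pi>s \<pi> a z\<bar> \<le> S" for z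
    unfolding S_def N_def by (rule complete_loglik_near_expected[OF \<open>0 < \<zeta>\<close> \<pi> D])
  note bounds = ln_observed_graph_bounds[OF G \<open>0 < \<delta>\<close> \<pi>01 e, folded L_def]
  have upper: "L \<le> N * ?M + R + S"
  proof (rule bounds(2))
    fix z
    show "complete_loglik n T \<pi> e z \<le> N * ?M + R + S"
      using near[of z] limit(1)[of z] \<open>2 \<le> n\<close> by linarith
  qed
  have "?M \<le> (L - real n * real T * ln \<delta> + R + S) / N"
  proof (rule limit_objective_bounds(2)[OF v F(1)])
    fix A :: "real ^ 'q ^ 'q" assume A: "stochastic_matrix A"
    then obtain z where "N * limit_objective_at \<Gamma>s \<pi>s \<pi> A \<le> expected_loglik n T \<pi>s \<pi> a z + R"
      using limit(2)[OF _ A] \<open>2 \<le> n\<close> by auto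
    then have "N * limit_objective_at \<Gamma>s \<pi>s \<pi> A \<le> L - real n * real T * ln \<delta> + R + S"
      using near[of z] bounds(1)[of z] by linarith
    then show "limit_objective_at \<Gamma>s \<pi>s \<pi> A \<le> (L - real n * real T * ln \<delta> + R + S) / N"
      using N_pos by (simp add: field_simps)
  qed
  then have lower: "N * ?M \<le> L - real n * real T * ln \<delta> + R + S"
    using N_pos by (simp add: field_simps)
  \<comment> \<open>\<open>ln \<delta> \<le> 0\<close>, so the error of the lower bound on \<open>L\<close> also covers the upper one.\<close>
  have "\<delta> \<le> 1"
    using G(2) order.trans[OF _ member_le_sum[of _ UNIV "($) (\<Gamma> $ undefined)"]] G(1)
    unfolding stochastic_matrix_def stochastic_vector_def by (metis UNIV_I finite_class.finite_UNIV)
  then have ln_\<delta>: "ln \<delta> \<le> 0" using \<open>0 < \<delta>\<close> by simp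
  then have "real n * real T * ln \<delta> \<le> 0" by (simp add: mult_nonneg_nonpos)
  then have abs: "\<bar>L - N * ?M\<bar> \<le> R + S - real n * real T * ln \<delta>"
    using upper lower by linarith
  have M: "normalized_loglik n T \<Gamma> \<pi> (adjacency e) = L / N"
    unfolding normalized_loglik_def L_def[symmetric] N by (simp add: mult_ac)
  \<comment> \<open>This is \<open>n T / N = 2 / (n - 1)\<close>, and \<open>n \<le> 2 (n - 1)\<close>.\<close>
  have ratio: "real n * real T / N \<le> 4 / real n"
    using \<open>2 \<le> n\<close> \<open>1 \<le> T\<close> by (simp add: N field_simps)
  have R_le: "R / N \<le> 4 * C * \<eta> + 8 * C / real n"
  proof -
    have "(real n)\<^sup>2 * C * label_discrepancy n T (stationary_distribution \<Gamma>s) a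
        \<le> (real n)\<^sup>2 * C * (\<eta> * real T)"
      using C by (intro mult_left_mono W) simp
    then have "R \<le> (real n * real T) * (real n * C * \<eta> + 2 * C)"
      unfolding R_def by (simp add: algebra_simps power2_eq_square)
    then have "R / N \<le> real n * real T / N * (real n * C * \<eta> + 2 * C)"
      using N_pos by (simp add: divide_right_mono)
    also have "\<dots> \<le> 4 / real n * (real n * C * \<eta> + 2 * C)"
      using C \<open>0 \<le> \<eta>\<close> by (intro mult_right_mono ratio) simp
    also have "\<dots> = 4 * C * \<eta> + 8 * C / real n"
      using \<open>2 \<le> n\<close> by (simp add: field_simps)
    finally show ?thesis .
  qed
  have \<delta>_le: "- (real n * real T * ln \<delta>) / N \<le> - 4 * ln \<delta> / real n"
    using mult_right_mono[OF ratio, of "- ln \<delta>"] ln_\<delta> by simp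
  have "L / N - ?M = (L - N * ?M) / N"
    using N_pos by (simp add: field_simps)
  then have "\<bar>L / N - ?M\<bar> = \<bar>L - N * ?M\<bar> / N"
    using N_pos by (simp add: abs_divide)
  also have "\<dots> \<le> (R + S - real n * real T * ln \<delta>) / N"
    using abs N_pos by (simp add: divide_right_mono)
  also have "\<dots> = R / N + (real CARD('q))\<^sup>2 * (- ln \<zeta>) * \<sigma> + - (real n * real T * ln \<delta>) / N"
    using N_pos by (simp add: S_def field_simps)
  also have "\<dots> \<le> (4 * C * \<eta> + 8 * C / real n) + (real CARD('q))\<^sup>2 * (- ln \<zeta>) * \<sigma> + - 4 * ln \<delta> / real n"
    by (intro add_mono R_le \<delta>_le order.refl)
  also have "\<dots> = - 4 * ln \<zeta> * \<eta> + (real CARD('q))\<^sup>2 * (- ln \<zeta>) * \<sigma> + (- 8 * ln \<zeta> - 4 * ln \<delta>) / real n"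
    by (simp add: C_def diff_divide_distrib)
  finally show "\<bar>normalized_loglik n T \<Gamma> \<pi> (adjacency e) - ?M\<bar>
      \<le> - 4 * ln \<zeta> * \<eta> + (real CARD('q))\<^sup>2 * (- ln \<zeta>) * \<sigma> + (- 8 * ln \<zeta> - 4 * ln \<delta>) / real n"
    by (simp only: M)
qed

section \<open>Probability bounds and the limit\<close>

text \<open>
  Conditioning on the labels: \<open>Z\<close> collects bad labels, \<open>X z\<close> the bad graphs when the labels are \<open>z\<close>.
\<close>

lemma prob_dsbm_le:
  assumes bad: "\<And>z x. x \<in> set_pmf (graphs_pmf n T \<pi> z) \<Longrightarrow> (z, x) \<in> B \<Longrightarrow> z \<notin> Z \<Longrightarrow> x \<in> X z"
    and X: "\<And>z. measure_pmf.prob (graphs_pmf n T \<pi> z) (X z) \<le> p"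
  shows "measure_pmf.prob (dsbm_pmf n T \<Gamma> \<pi>) B \<le> measure_pmf.prob (labels_pmf n T \<Gamma>) Z + p"
proof -
  have p: "0 \<le> p" using X by (rule order.trans[OF measure_nonneg])
  have "emeasure (dsbm_pmf n T \<Gamma> \<pi>) B
      = (\<integral>\<^sup>+z. emeasure (graphs_pmf n T \<pi> z) {x. (z, x) \<in> B} \<partial>labels_pmf n T \<Gamma>)"
    unfolding dsbm_pmf_def by (simp add: vimage_def)
  also have "\<dots> \<le> (\<integral>\<^sup>+z. indicator Z z + ennreal p \<partial>labels_pmf n T \<Gamma>)"
  proof (rule nn_integral_mono)
    fix z
    show "emeasure (graphs_pmf n T \<pi> z) {x. (z, x) \<in> B} \<le> indicator Z z + ennreal p"
    proof (cases "z \<in> Z")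
      case True
      have "emeasure (graphs_pmf n T \<pi> z) {x. (z, x) \<in> B} \<le> 1"
        by (rule measure_pmf.emeasure_le_1)
      also have "\<dots> \<le> indicator Z z + ennreal p"
        using True by simp
      finally show ?thesis .
    next
      case False
      have "emeasure (graphs_pmf n T \<pi> z) {x. (z, x) \<in> B} \<le> emeasure (graphs_pmf n T \<pi> z) (X z)"
        using bad[of _ z] False by (intro emeasure_mono_AE) (auto simp: AE_measure_pmf_iff)
      also have "\<dots> \<le> ennreal p"
        using X[of z] by (simp add: measure_pmf.emeasure_eq_measure ennreal_leI)
      finally show ?thesis using False by simp
    qed
  qed
  also have "\<dots> = emeasure (labels_pmf n T \<Gamma>) Z + ennreal p"
    by (simp add: nn_integral_add)
  also have "\<dots> = ennreal (measure_pmf.prob (labels_pmf n T \<Gamma>) Z + p)"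
    using p by (simp add: measure_pmf.emeasure_eq_measure)
  finally show ?thesis
    using p by (simp add: measure_pmf.emeasure_eq_measure del: ennreal_plus)
qed

lemma uniform_deviation_tail:
  fixes \<Gamma>s \<pi>s :: "real ^ 'q ^ 'q::finite"
  assumes \<theta>s: "(\<Gamma>s, \<pi>s) \<in> param_space \<delta> \<zeta>" and "0 < \<delta>" "0 < \<zeta>" and "2 \<le> n" "1 \<le> T"
    and "0 < \<eta>" "0 \<le> \<sigma>"
  shows "measure_pmf.prob (dsbm_pmf n T \<Gamma>s \<pi>s) {(z, x). uniform_deviation \<delta> \<zeta> n T \<Gamma>s \<pi>s x
      > - 4 * ln \<zeta> * \<eta> + (real CARD('q))\<^sup>2 * (- ln \<zeta>) * \<sigma> + (- 8 * ln \<zeta> - 4 * ln \<delta>) / real n}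
    \<le> real CARD('q) / (\<eta> * sqrt (real n))
      + (real CARD('q) ^ T) ^ n * (real CARD('q))\<^sup>2 * (2 * exp (- \<sigma>\<^sup>2 * (real n * (real n - 1) * real T)))"
    (is "measure_pmf.prob _ {(z, x). _ > ?bd} \<le> _ + ?p")
proof -
  let ?N = "real (card (edge_indices n T))"
  let ?bad = "\<lambda>a. {e. \<exists>z c. \<sigma> * ?N \<le> \<bar>edge_excess n T \<pi>s a e z c\<bar>}"
  let ?P = "\<lambda>a. Pi_pmf (edge_indices n T) False (\<lambda>(t, i, j). bernoulli_pmf (\<pi>s $ a i t $ a j t))"
  let ?X = "\<lambda>a. adjacency ` (?bad a \<inter> {e. \<forall>k. k \<notin> edge_indices n T \<longrightarrow> \<not> e k})"
  let ?Z = "{a. \<eta> * real T \<le> label_discrepancy n T (stationary_distribution \<Gamma>s) a}"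
  have Gs: "stochastic_matrix \<Gamma>s" "\<And>q l. \<delta> \<le> \<Gamma>s $ q $ l" and "\<And>q l. \<pi>s $ q $ l \<in> {\<zeta>..1 - \<zeta>}"
    using \<theta>s unfolding param_space_def by auto
  then have \<pi>s: "\<pi>s $ q $ l \<in> {0..1}" for q l
    using \<open>0 < \<zeta>\<close> by (meson atLeastAtMost_iff diff_le_eq le_add_same_cancel1 less_imp_le order.trans)
  have N_pos: "0 < ?N" using \<open>2 \<le> n\<close> \<open>1 \<le> T\<close> by (simp add: card_edge_indices)
  have support: "set_pmf (?P a) \<subseteq> {e. \<forall>k. k \<notin> edge_indices n T \<longrightarrow> \<not> e k}" for a
    using set_Pi_pmf_subset[of "edge_indices n T" False] by simp
  have "measure_pmf.prob (dsbm_pmf n T \<Gamma>s \<pi>s) {(z, x). uniform_deviation \<delta> \<zeta> n T \<Gamma>s \<pi>s x > ?bd}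
      \<le> measure_pmf.prob (labels_pmf n T \<Gamma>s) ?Z + ?p"
  proof (rule prob_dsbm_le[where X = ?X])
    fix a x
    assume x: "x \<in> set_pmf (graphs_pmf n T \<pi>s a)"
      and dev: "(a, x) \<in> {(z, x). uniform_deviation \<delta> \<zeta> n T \<Gamma>s \<pi>s x > ?bd}" and a: "a \<notin> ?Z"
    from x obtain e where e: "e \<in> set_pmf (?P a)" "x = adjacency e"
      by (auto simp: graphs_pmf_def)
    have "e \<in> ?bad a"
    proof (rule ccontr)
      assume "e \<notin> ?bad a"
      then have "uniform_deviation \<delta> \<zeta> n T \<Gamma>s \<pi>s (adjacency e) \<le> ?bd"
        using a support[of a] e(1) \<open>0 < \<eta>\<close>
        by (intro uniform_deviation_le[where a = a, OF \<theta>s \<open>0 < \<delta>\<close> \<open>0 < \<zeta>\<close> \<open>2 \<le> n\<close> \<open>1 \<le> T\<close>])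
          (auto simp: not_le less_imp_le)
      with dev e(2) show False by simp
    qed
    then show "x \<in> ?X a" using e support[of a] by blast
  next
    fix a
    have "measure_pmf.prob (graphs_pmf n T \<pi>s a) (?X a) = measure_pmf.prob (?P a) (adjacency -` ?X a)"
      by (simp add: graphs_pmf_def)
    also have "\<dots> \<le> measure_pmf.prob (?P a) (?bad a)"
    proof (rule measure_pmf.finite_measure_mono_AE)
      show "AE e in ?P a. e \<in> adjacency -` ?X a \<longrightarrow> e \<in> ?bad a"
        unfolding AE_measure_pmf_iff
      proof (intro ballI impI)
        fix e assume "e \<in> set_pmf (?P a)" "e \<in> adjacency -` ?X a"
        then show "e \<in> ?bad a"
          using support[of a] inj_onD[OF inj_on_adjacency, of e _ n T] by blast
      qed
    qed simp
    also have "\<dots> \<le> (real CARD('q) ^ T) ^ n * (real CARD('q))\<^sup>2 * (2 * exp (- 2 * (\<sigma> * ?N)\<^sup>2 / ?N))"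
      using \<open>2 \<le> n\<close> \<open>1 \<le> T\<close> \<open>0 \<le> \<sigma>\<close> by (intro edge_excess_tail \<pi>s) auto
    also have "- 2 * (\<sigma> * ?N)\<^sup>2 / ?N = - \<sigma>\<^sup>2 * (2 * ?N)"
      using N_pos by (simp add: power2_eq_square)
    also have "2 * ?N = real n * (real n - 1) * real T"
      by (simp add: card_edge_indices mult_ac)
    finally show "measure_pmf.prob (graphs_pmf n T \<pi>s a) (?X a) \<le> ?p" .
  qed
  also have "measure_pmf.prob (labels_pmf n T \<Gamma>s) ?Z \<le> real CARD('q) / (\<eta> * sqrt (real n))"
    using \<open>2 \<le> n\<close> \<open>1 \<le> T\<close> \<open>0 < \<eta>\<close> by (intro label_discrepancy_tail[OF Gs \<open>0 < \<delta>\<close>]) auto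
  finally show ?thesis by simp
qed

text \<open>
  The thresholds \<open>\<eta>\<close> and \<open>\<sigma>\<close> are chosen so that each of the three terms of the bound is at most a third of
  \<open>\<epsilon> r / sqrt n\<close>, the last one because \<open>r\<close> is large.
\<close>

lemma uniform_deviation_tail_rate:
  fixes \<Gamma>s \<pi>s :: "real ^ 'q ^ 'q::finite"
  assumes \<theta>s: "(\<Gamma>s, \<pi>s) \<in> param_space \<delta> \<zeta>" and "0 < \<delta>" "0 < \<zeta>" "\<zeta> < 1 / 2" "0 < \<epsilon>"
  obtains r0 c where "\<And>n T r. 2 \<le> n \<Longrightarrow> 1 \<le> T \<Longrightarrow> r0 \<le> r \<Longrightarrow>
    measure_pmf.prob (dsbm_pmf n T \<Gamma>s \<pi>s)
      {(z, x). uniform_deviation \<delta> \<zeta> n T \<Gamma>s \<pi>s x > \<epsilon> * r / sqrt (real n)}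
    \<le> c / r + 2 * (real CARD('q))\<^sup>2 * exp (- real n)"
proof -
  define Q where "Q = real CARD('q)"
  define C where "C = - ln \<zeta>"
  define K where "K = 8 * C - 4 * ln \<delta>"
  define \<kappa> where "\<kappa> = \<epsilon>\<^sup>2 / (9 * Q ^ 4 * C\<^sup>2)"
  define r0 where "r0 = max 1 (max (3 * K / \<epsilon>) (2 * (ln Q + 1) / \<kappa>))"
  have C: "0 < C" using assms by (simp add: C_def)
  have Q: "1 \<le> Q" by (simp add: Q_def Suc_leI)
  have \<kappa>: "0 < \<kappa>" using C Q \<open>0 < \<epsilon>\<close> by (simp add: \<kappa>_def)
  have "measure_pmf.prob (dsbm_pmf n T \<Gamma>s \<pi>s)
      {(z, x). uniform_deviation \<delta> \<zeta> n T \<Gamma>s \<pi>s x > \<epsilon> * r / sqrt (real n)}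
    \<le> 12 * C * Q / \<epsilon> / r + 2 * (real CARD('q))\<^sup>2 * exp (- real n)"
    if "2 \<le> n" "1 \<le> T" "r0 \<le> r" for n T r
  proof -
    have r: "1 \<le> r" "3 * K / \<epsilon> \<le> r" "2 * (ln Q + 1) / \<kappa> \<le> r"
      using \<open>r0 \<le> r\<close> by (simp_all add: r0_def)
    define \<rho> where "\<rho> = r / sqrt (real n)"
    define \<eta> where "\<eta> = \<epsilon> * \<rho> / (12 * C)"
    define \<sigma> where "\<sigma> = \<epsilon> * \<rho> / (3 * Q\<^sup>2 * C)"
    have sqrt_n: "1 \<le> sqrt (real n)" "sqrt (real n) * sqrt (real n) = real n"
      using \<open>2 \<le> n\<close> by simp_all
    have \<rho>: "0 < \<rho>" using r \<open>2 \<le> n\<close> by (simp add: \<rho>_def)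
    have pos: "0 < \<eta>" "0 \<le> \<sigma>" using \<rho> C Q \<open>0 < \<epsilon>\<close> by (simp_all add: \<eta>_def \<sigma>_def)
    have \<rho>_sqrt: "\<rho> * sqrt (real n) = r" using \<open>2 \<le> n\<close> by (simp add: \<rho>_def)
    have "K / real n \<le> \<epsilon> * \<rho> / 3"
    proof -
      have "3 * K \<le> \<epsilon> * r"
        using r(2) \<open>0 < \<epsilon>\<close> by (simp add: field_simps)
      also have "\<dots> \<le> \<epsilon> * r * sqrt (real n)"
        using r(1) \<open>0 < \<epsilon>\<close> sqrt_n(1) by (simp add: mult_left_le)
      also have "\<dots> = \<epsilon> * \<rho> * (sqrt (real n) * sqrt (real n))"
        by (simp only: \<rho>_sqrt[symmetric] mult.assoc)
      also have "\<dots> = \<epsilon> * \<rho> * real n"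
        by (simp only: sqrt_n(2))
      finally show ?thesis using \<open>2 \<le> n\<close> by (simp add: field_simps)
    qed
    moreover have "4 * C * \<eta> = \<epsilon> * \<rho> / 3" "Q\<^sup>2 * C * \<sigma> = \<epsilon> * \<rho> / 3"
      using C Q by (simp_all add: \<eta>_def \<sigma>_def)
    ultimately have threshold: "4 * C * \<eta> + Q\<^sup>2 * C * \<sigma> + K / real n \<le> \<epsilon> * r / sqrt (real n)"
      by (simp add: \<rho>_def)
    have labels: "Q / (\<eta> * sqrt (real n)) = 12 * C * Q / \<epsilon> / r"
      using \<open>2 \<le> n\<close> by (simp add: \<eta>_def \<rho>_def)
    \<comment> \<open>The deviation is chosen so that \<open>\<sigma>\<^sup>2 n = \<kappa> r\<^sup>2\<close>. Half of the exponent is lost to \<open>n - 1 \<ge> n / 2\<close>; the rest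
      exceeds the entropy \<open>n T ln Q\<close> by at least \<open>n T\<close>.\<close>
    have edges: "(Q ^ T) ^ n * exp (- \<sigma>\<^sup>2 * (real n * (real n - 1) * real T)) \<le> exp (- real n)"
    proof -
      have "ln Q + 1 \<le> \<kappa> * r / 2"
        using r(3) \<kappa> by (simp add: field_simps)
      also have "\<dots> \<le> \<kappa> * r\<^sup>2 / 2"
        using r(1) \<kappa> by (simp add: power2_eq_square)
      finally have rate: "ln Q + 1 \<le> \<kappa> * r\<^sup>2 / 2" .
      have "\<sigma>\<^sup>2 * real n = \<kappa> * r\<^sup>2"
        using \<open>2 \<le> n\<close> by (simp add: \<sigma>_def \<kappa>_def \<rho>_def power_mult_distrib power_divide)
      then have "\<sigma>\<^sup>2 * (real n * (real n - 1) * real T) = \<kappa> * r\<^sup>2 * ((real n - 1) * real T)"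
        by (simp add: mult.assoc[symmetric])
      moreover have "(ln Q + 1) * (real n * real T) \<le> \<kappa> * r\<^sup>2 / 2 * (real n * real T)"
        using rate by (rule mult_right_mono) simp
      moreover have "\<kappa> * r\<^sup>2 * (real n / 2 * real T) \<le> \<kappa> * r\<^sup>2 * ((real n - 1) * real T)"
        using \<kappa> \<open>2 \<le> n\<close> by (intro mult_left_mono mult_right_mono) simp_all
      moreover have "real n \<le> real n * real T"
        using \<open>1 \<le> T\<close> mult_left_mono[of 1 "real T" "real n"] by simp
      ultimately have "real n * real T * ln Q - \<sigma>\<^sup>2 * (real n * (real n - 1) * real T) \<le> - real n"
        by (simp add: algebra_simps)
      moreover have "(Q ^ T) ^ n = exp (real n * real T * ln Q)"
        using Q by (simp add: exp_of_nat_mult mult.assoc)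
      ultimately show ?thesis
        by (simp flip: exp_add)
    qed
    have "measure_pmf.prob (dsbm_pmf n T \<Gamma>s \<pi>s)
        {(z, x). uniform_deviation \<delta> \<zeta> n T \<Gamma>s \<pi>s x > \<epsilon> * r / sqrt (real n)}
      \<le> measure_pmf.prob (dsbm_pmf n T \<Gamma>s \<pi>s)
        {(z, x). uniform_deviation \<delta> \<zeta> n T \<Gamma>s \<pi>s x > 4 * C * \<eta> + Q\<^sup>2 * C * \<sigma> + K / real n}"
      using threshold by (intro measure_pmf.finite_measure_mono) auto
    also have "\<dots> \<le> Q / (\<eta> * sqrt (real n))
        + (Q ^ T) ^ n * Q\<^sup>2 * (2 * exp (- \<sigma>\<^sup>2 * (real n * (real n - 1) * real T)))"
      using uniform_deviation_tail[OF \<theta>s \<open>0 < \<delta>\<close> \<open>0 < \<zeta>\<close> \<open>2 \<le> n\<close> \<open>1 \<le> T\<close>, of \<eta> \<sigma>] pos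
      by (simp add: C_def K_def Q_def)
    also have "\<dots> = 12 * C * Q / \<epsilon> / r
        + 2 * Q\<^sup>2 * ((Q ^ T) ^ n * exp (- \<sigma>\<^sup>2 * (real n * (real n - 1) * real T)))"
      by (simp add: labels)
    also have "\<dots> \<le> 12 * C * Q / \<epsilon> / r + 2 * Q\<^sup>2 * exp (- real n)"
      by (intro add_left_mono mult_left_mono edges) simp
    finally show ?thesis by (simp add: Q_def)
  qed
  then show thesis by (rule that)
qed

theorem theorem1:
  fixes \<delta> \<zeta> \<epsilon> :: real
    and \<Gamma>s \<pi>s :: "real ^ 'q ^ 'q::finite"
    and r :: "nat \<Rightarrow> nat \<Rightarrow> real"
    and F :: "(nat \<times> nat) filter"
  assumes "CARD('q) \<ge> 2"
    and "0 < \<delta>" "\<delta> < 1 / real CARD('q)"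
    and "0 < \<zeta>" "\<zeta> < 1 / 2"
    and "(\<Gamma>s, \<pi>s) \<in> param_space \<delta> \<zeta>"
    and "filterlim fst at_top F" "filterlim snd at_top F"
    and "(\<lambda>(n, T). ln (real T)) \<in> o[F](\<lambda>(n, T). real n)"
    and "\<And>n T. n \<ge> 1 \<Longrightarrow> T \<ge> 1 \<Longrightarrow> r n T > 0"
    and "filterlim (\<lambda>(n, T). r n T) at_top F"
    and "\<epsilon> > 0"
  shows "((\<lambda>(n, T). measure_pmf.prob (dsbm_pmf n T \<Gamma>s \<pi>s)
             {(z, x). uniform_deviation \<delta> \<zeta> n T \<Gamma>s \<pi>s x > \<epsilon> * r n T / sqrt (real n)})
          \<longlongrightarrow> 0) F"
proof -
  obtain r0 c where tail: "\<And>n T r. 2 \<le> n \<Longrightarrow> 1 \<le> T \<Longrightarrow> r0 \<le> r \<Longrightarrow>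
      measure_pmf.prob (dsbm_pmf n T \<Gamma>s \<pi>s)
        {(z, x). uniform_deviation \<delta> \<zeta> n T \<Gamma>s \<pi>s x > \<epsilon> * r / sqrt (real n)}
      \<le> c / r + 2 * (real CARD('q))\<^sup>2 * exp (- real n)"
    using uniform_deviation_tail_rate[OF assms(6,2,4,5,12)] by metis
  let ?bound = "\<lambda>p. c / (case p of (n, T) \<Rightarrow> r n T) + 2 * (real CARD('q))\<^sup>2 * exp (- real (fst p))"
  have "\<forall>\<^sub>F p in F. 2 \<le> fst p \<and> 1 \<le> snd p \<and> r0 \<le> (case p of (n, T) \<Rightarrow> r n T)"
    using assms(7,8,11) by (simp add: filterlim_at_top eventually_conj_iff)
  then have upper: "\<forall>\<^sub>F p in F. (case p of (n, T) \<Rightarrow> measure_pmf.prob (dsbm_pmf n T \<Gamma>s \<pi>s)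
      {(z, x). uniform_deviation \<delta> \<zeta> n T \<Gamma>s \<pi>s x > \<epsilon> * r n T / sqrt (real n)}) \<le> ?bound p"
  proof eventually_elim
    case (elim p)
    then show ?case
      using tail[of "fst p" "snd p" "r (fst p) (snd p)"] by (simp add: case_prod_beta)
  qed
  have "filterlim (\<lambda>p. real (fst p)) at_top F"
    by (rule filterlim_compose[OF filterlim_real_sequentially assms(7)])
  then have "((\<lambda>p. exp (- real (fst p))) \<longlongrightarrow> 0) F"
    by (intro filterlim_compose[OF exp_at_bot] filterlim_compose[OF filterlim_uminus_at_bot_at_top])
  then have "((\<lambda>p. 2 * (real CARD('q))\<^sup>2 * exp (- real (fst p))) \<longlongrightarrow> 0) F"
    by (rule tendsto_mult_right_zero)
  moreover have "((\<lambda>p. c / (case p of (n, T) \<Rightarrow> r n T)) \<longlongrightarrow> 0) F"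
    by (intro tendsto_divide_0[OF tendsto_const] filterlim_at_top_imp_at_infinity assms(11))
  ultimately have lim: "(?bound \<longlongrightarrow> 0) F"
    using tendsto_add_zero by fastforce
  show ?thesis
    by (rule tendsto_sandwich[OF _ upper tendsto_const lim]) (auto simp: case_prod_beta)
qed

end
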